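(* Let $n\ge3$ and let $w\in W(\tilde A_n)$ with $L(w)=m\ge1$ be given in its canonical form $$w=h(j_1,i_1)a_{n+1}\,h(j_2,i_2)a_{n+1}\cdots h(j_m,i_m)a_{n+1}\,x,\qquad x\in W(A_n).$$ Then $w\in R_n(W(\tilde A_{n-1}))$ if and only if the following conditions hold: <br>(1) $j_1\le n$ and $i_1<n-1$; <br>(2) letting $s=\max\{k: 1\le k\le m,\ i_k<n-k\}$, one has $i_{s+1}>n-(s+1)$ (this condition being void if $s=m$); <br>(3) $x=\lfloor n-s+1,n\rfloor\,y$ with $y\in W(A_{n-1})$.
   Context: For $N\ge2$, $W(\tilde A_N)$ is the Coxeter group with generating set $\{\sigma_1,\dots,\sigma_N,a_{N+1}\}$ whose Coxeter graph is the cycle $\sigma_1-\sigma_2-\cdots-\sigma_N-a_{N+1}-\sigma_1$ (all edges of label 3). $W(A_N)$ is the parabolic subgroup generated by $\sigma_1,\dots,\sigma_N$. The affine length $L(w)$ of $w\in W(\tilde A_N)$ is the minimal number of occurrences of $a_{N+1}$ among all reduced expressions of $w$. Notation: $\lfloor i,j\rfloor=\sigma_i\sigma_{i+1}\cdots\sigma_j$ for $1\le i\le j\le n$, $\lfloor n+1,n\rfloor=1$; $\lceil i,j\rceil=\sigma_i\sigma_{i-1}\cdots\sigma_j$ for $n\ge i\ge j\ge1$, $\lceil 0,1\rceil=1$; $h(r,i)=\lfloor r,n\rfloor\lceil i,1\rceil$ for $1\le r\le n+1$, $0\le i\le n-1$. The canonical form of $w\in W(\tilde A_n)$ with $L(w)=m\ge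 1$ is the unique way to write $w=h(j_1,i_1)a_{n+1}\cdots h(j_m,i_m)a_{n+1}x$ with $x\in W(A_n)$ and $(j_s,i_s)_{1\le s\le m}$ satisfying the pairwise inequalities: (i) $1\le j_1\le n+1$, $0\le i_1\le n-1$; (ii) for $2\le s\le m$, either $i_s=0$ and $j_s=1$, or $1\le i_s\le n-1$ and $1\le j_s\le n$; (iii) for $2\le s\le m$, $j_s\le j_{s-1}$ and $i_s\ge i_{s-1}$; (iv) for $2\le s\le m$, if $j_{s-1}>i_{s-1}+1$ then $j_s<j_{s-1}$; (v) for $2\le s\le m$, if $j_s>i_s+1$ then $i_s>i_{s-1}$. (Existence and uniqueness are known.) $R_n:W(\tilde A_{n-1})\to W(\tilde A_n)$ is the group monomorphism with $R_n(\sigma_i)=\sigma_i$ for $1\le i\le n-1$ and $R_n(a_n)=\sigma_na_{n+1}\sigma_n$. *)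

theory Defs
  imports "HOL-Algebra.Generated_Groups"
begin

section \<open>Coxeter groups\<close>

text \<open>
  The Coxeter group of a Coxeter matrix \<open>M\<close> on the generating set \<open>S\<close> is given by its
  presentation \<open>\<langle>S | (s t)^M(s,t) = 1\<rangle>\<close>; the value \<open>M s t = 0\<close> encodes the label infinity
  (no relation). Since \<open>M s s = 1\<close> makes every generator an involution, the group is the quotient
  of the free monoid of words over \<open>S\<close> by the congruence generated by these relations.
\<close>

inductive_set coxeter_rel :: "'s set \<Rightarrow> ('s \<Rightarrow> 's \<Rightarrow> nat) \<Rightarrow> ('s list \<times> 's list) set"
  for S :: "'s set" and M :: "'s \<Rightarrow> 's \<Rightarrow> nat" where
  refl: "u \<in> lists S \<Longrightarrow> (u, u) \<in> coxeter_rel S M"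
| sym: "(u, v) \<in> coxeter_rel S M \<Longrightarrow> (v, u) \<in> coxeter_rel S M"
| trans: "(u, v) \<in> coxeter_rel S M \<Longrightarrow> (v, w) \<in> coxeter_rel S M \<Longrightarrow> (u, w) \<in> coxeter_rel S M"
| rel: "s \<in> S \<Longrightarrow> t \<in> S \<Longrightarrow> M s t \<noteq> 0 \<Longrightarrow> u \<in> lists S \<Longrightarrow> v \<in> lists S \<Longrightarrow>
    (u @ concat (replicate (M s t) [s, t]) @ v, u @ v) \<in> coxeter_rel S M"

definition word_class :: "'s set \<Rightarrow> ('s \<Rightarrow> 's \<Rightarrow> nat) \<Rightarrow> 's list \<Rightarrow> 's list set" where
  "word_class S M u = coxeter_rel S M `` {u}"

definition coxeter_group :: "'s set \<Rightarrow> ('s \<Rightarrow> 's \<Rightarrow> nat) \<Rightarrow> 's list set monoid" where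
  "coxeter_group S M =
    \<lparr>carrier = lists S // coxeter_rel S M,
     mult = (\<lambda>X Y. \<Union>u\<in>X. \<Union>v\<in>Y. word_class S M (u @ v)),
     one = word_class S M []\<rparr>"

text \<open>
  An element \<open>w\<close> of the group is a class of words, and these words are exactly the expressions of
  \<open>w\<close> in the generators.
\<close>

definition reduced_expression :: "'s list set \<Rightarrow> 's list \<Rightarrow> bool" where
  "reduced_expression w u \<longleftrightarrow> u \<in> w \<and> (\<forall>v\<in>w. length u \<le> length v)"

definition word_prod :: "('a, 'b) monoid_scheme \<Rightarrow> 'a list \<Rightarrow> 'a" where
  "word_prod G xs = foldr (\<otimes>\<^bsub>G\<^esub>) xs \<one>\<^bsub>G\<^esub>"


section \<open>The affine group of type A and its parabolic subgroups\<close>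

text \<open>
  The generators are numbered along the cycle: \<open>k \<in> {1..N}\<close> stands for \<open>\<sigma>\<^sub>k\<close> and
  \<open>N + 1\<close> stands for \<open>a\<^bsub>N+1\<^esub>\<close>.
\<close>

definition affA_matrix :: "nat \<Rightarrow> nat \<Rightarrow> nat \<Rightarrow> nat" where
  "affA_matrix N s t =
    (if s = t then 1
     else if t = s + 1 \<or> s = t + 1 \<or> {s, t} = {1, N + 1} then 3
     else 2)"

definition affA :: "nat \<Rightarrow> nat list set monoid" where
  "affA N = coxeter_group {1..N + 1} (affA_matrix N)"

definition gen :: "nat \<Rightarrow> nat \<Rightarrow> nat list set" where
  "gen N k = word_class {1..N + 1} (affA_matrix N) [k]"

abbreviation (input) sigma :: "nat \<Rightarrow> nat \<Rightarrow> nat list set" where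
  "sigma N k \<equiv> gen N k"

abbreviation (input) aff :: "nat \<Rightarrow> nat list set" where
  "aff N \<equiv> gen N (N + 1)"

text \<open>\<open>W(A\<^sub>k)\<close> as a parabolic subgroup of the affine group of rank \<open>N + 1\<close>, for \<open>k \<le> N\<close>.\<close>

definition WA :: "nat \<Rightarrow> nat \<Rightarrow> nat list set set" where
  "WA N k = generate (affA N) (sigma N ` {1..k})"

definition affine_length :: "nat \<Rightarrow> nat list set \<Rightarrow> nat" where
  "affine_length N w = (LEAST c. \<exists>u. reduced_expression w u \<and> count_list u (N + 1) = c)"


section \<open>Canonical forms\<close>

text \<open>
  \<open>asc n i j\<close> and \<open>dsc n i j\<close> are the products \<open>\<lfloor>i,j\<rfloor>\<close> and \<open>\<lceil>i,j\<rceil>\<close> in the affine group of rank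
  \<open>n + 1\<close>; the conventions \<open>\<lfloor>n+1,n\<rfloor> = 1\<close> and \<open>\<lceil>0,1\<rceil> = 1\<close> are the empty products.
\<close>

definition asc :: "nat \<Rightarrow> nat \<Rightarrow> nat \<Rightarrow> nat list set" where
  "asc n i j = word_prod (affA n) (map (sigma n) [i..<j + 1])"

definition dsc :: "nat \<Rightarrow> nat \<Rightarrow> nat \<Rightarrow> nat list set" where
  "dsc n i j = word_prod (affA n) (map (sigma n) (rev [j..<i + 1]))"

definition hh :: "nat \<Rightarrow> nat \<Rightarrow> nat \<Rightarrow> nat list set" where
  "hh n r i = asc n r n \<otimes>\<^bsub>affA n\<^esub> dsc n i 1"

definition pairwise_inequalities :: "nat \<Rightarrow> nat \<Rightarrow> (nat \<Rightarrow> nat) \<Rightarrow> (nat \<Rightarrow> nat) \<Rightarrow> bool" where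
  "pairwise_inequalities n m j i \<longleftrightarrow>
    (1 \<le> j 1 \<and> j 1 \<le> n + 1 \<and> i 1 \<le> n - 1) \<and>
    (\<forall>s\<in>{2..m}. (i s = 0 \<and> j s = 1) \<or> (1 \<le> i s \<and> i s \<le> n - 1 \<and> 1 \<le> j s \<and> j s \<le> n)) \<and>
    (\<forall>s\<in>{2..m}. j s \<le> j (s - 1) \<and> i s \<ge> i (s - 1)) \<and>
    (\<forall>s\<in>{2..m}. j (s - 1) > i (s - 1) + 1 \<longrightarrow> j s < j (s - 1)) \<and>
    (\<forall>s\<in>{2..m}. j s > i s + 1 \<longrightarrow> i s > i (s - 1))"

definition canonical_form ::
  "nat \<Rightarrow> nat \<Rightarrow> (nat \<Rightarrow> nat) \<Rightarrow> (nat \<Rightarrow> nat) \<Rightarrow> nat list set \<Rightarrow> nat list set \<Rightarrow> bool" where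
  "canonical_form n m j i x w \<longleftrightarrow>
    pairwise_inequalities n m j i \<and>
    x \<in> WA n n \<and>
    w = word_prod (affA n) (map (\<lambda>s. hh n (j s) (i s) \<otimes>\<^bsub>affA n\<^esub> aff n) [1..<m + 1])
          \<otimes>\<^bsub>affA n\<^esub> x"


section \<open>The embedding of the affine group of the previous rank\<close>

definition R_gen :: "nat \<Rightarrow> nat \<Rightarrow> nat list set" where
  "R_gen n k =
    (if k = n then sigma n n \<otimes>\<^bsub>affA n\<^esub> aff n \<otimes>\<^bsub>affA n\<^esub> sigma n n else sigma n k)"

text \<open>
  The homomorphism induced by \<open>R_gen\<close>: every expression of \<open>w\<close> is mapped to the same element.
  Well-definedness, the homomorphism property and the values on generators are proved below
  (\<open>R_hom\<close>, \<open>R_sigma\<close>, \<open>R_aff\<close>).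
\<close>

definition R :: "nat \<Rightarrow> nat list set \<Rightarrow> nat list set" where
  "R n w = the_elem ((\<lambda>u. word_prod (affA n) (map (R_gen n) u)) ` w)"


section \<open>Basic facts\<close>

lemma coxeter_rel_lists:
  assumes "(u, v) \<in> coxeter_rel S M"
  shows "u \<in> lists S \<and> v \<in> lists S"
  using assms
proof induction
  case (rel s t u v)
  then show ?case by (auto simp: in_lists_conv_set)
qed auto

lemma equiv_coxeter_rel: "equiv (lists S) (coxeter_rel S M)"
  using coxeter_rel_lists[of _ _ S M]
  by (auto intro!: equivI refl_onI symI transI intro: coxeter_rel.intros)

lemma coxeter_rel_append:
  assumes "(u, v) \<in> coxeter_rel S M" "a \<in> lists S" "b \<in> lists S"
  shows "(a @ u @ b, a @ v @ b) \<in> coxeter_rel S M"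
  using assms
proof (induction)
  case (refl u)
  then show ?case by (intro coxeter_rel.refl) simp
next
  case (rel s t u v)
  then show ?case
    using coxeter_rel.rel[of s S t M "a @ u" "v @ b"] by simp
qed (blast intro: coxeter_rel.sym coxeter_rel.trans)+

lemma coxeter_rel_append2:
  assumes "(u, u') \<in> coxeter_rel S M" "(v, v') \<in> coxeter_rel S M"
  shows "(u @ v, u' @ v') \<in> coxeter_rel S M"
proof -
  have "([] @ u @ v, [] @ u' @ v) \<in> coxeter_rel S M"
    by (rule coxeter_rel_append) (use assms coxeter_rel_lists in blast)+
  moreover have "(u' @ v @ [], u' @ v' @ []) \<in> coxeter_rel S M"
    by (rule coxeter_rel_append) (use assms coxeter_rel_lists in blast)+
  ultimately show ?thesis by (auto intro: coxeter_rel.trans)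
qed

lemma word_class_eq_iff:
  assumes "u \<in> lists S" "v \<in> lists S"
  shows "word_class S M u = word_class S M v \<longleftrightarrow> (u, v) \<in> coxeter_rel S M"
  unfolding word_class_def using equiv_class_eq_iff[OF equiv_coxeter_rel] assms by blast

lemma word_class_self: "u \<in> lists S \<Longrightarrow> u \<in> word_class S M u"
  by (simp add: word_class_def coxeter_rel.refl)

lemma word_class_carrier: "u \<in> lists S \<Longrightarrow> word_class S M u \<in> carrier (coxeter_group S M)"
  by (simp add: coxeter_group_def word_class_def quotientI)

lemma coxeter_group_carrierE:
  assumes "X \<in> carrier (coxeter_group S M)"
  obtains u where "u \<in> lists S" "X = word_class S M u"
  using assms by (auto simp: coxeter_group_def word_class_def elim!: quotientE)

lemma coxeter_group_mult:
  assumes "u \<in> lists S" "v \<in> lists S"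
  shows "word_class S M u \<otimes>\<^bsub>coxeter_group S M\<^esub> word_class S M v = word_class S M (u @ v)"
proof -
  have class_eq: "word_class S M (u' @ v') = word_class S M (u @ v)"
    if "u' \<in> word_class S M u" "v' \<in> word_class S M v" for u' v'
  proof -
    have "(u, u') \<in> coxeter_rel S M" "(v, v') \<in> coxeter_rel S M"
      using that by (auto simp: word_class_def)
    then have *: "(u @ v, u' @ v') \<in> coxeter_rel S M" by (rule coxeter_rel_append2)
    have "u @ v \<in> lists S" "u' @ v' \<in> lists S" using coxeter_rel_lists[OF *] by blast+
    then show ?thesis using word_class_eq_iff[of "u @ v" S "u' @ v'" M] * by simp
  qed
  have "word_class S M u \<otimes>\<^bsub>coxeter_group S M\<^esub> word_class S M v
      = (\<Union>u'\<in>word_class S M u. \<Union>v'\<in>word_class S M v. word_class S M (u @ v))"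
    by (simp add: coxeter_group_def class_eq)
  also have "\<dots> = word_class S M (u @ v)"
    using word_class_self[OF assms(1)] word_class_self[OF assms(2)] by blast
  finally show ?thesis .
qed

lemma coxeter_group_one: "\<one>\<^bsub>coxeter_group S M\<^esub> = word_class S M []"
  by (simp add: coxeter_group_def)

lemma coxeter_rel_rev:
  assumes "\<And>s. s \<in> S \<Longrightarrow> M s s = 1" "u \<in> lists S"
  shows "(rev u @ u, []) \<in> coxeter_rel S M"
  using assms(2)
proof (induction u)
  case Nil
  then show ?case by (simp add: coxeter_rel.refl)
next
  case (Cons s u)
  have "(rev u @ [s, s] @ u, rev u @ u) \<in> coxeter_rel S M"
    using coxeter_rel.rel[of s S s M "rev u" u] Cons assms(1) by (auto simp: in_lists_conv_set)
  then show ?case using Cons by (auto intro: coxeter_rel.trans)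
qed

lemma group_coxeter_group:
  assumes "\<And>s. s \<in> S \<Longrightarrow> M s s = 1"
  shows "group (coxeter_group S M)"
proof (rule groupI)
  fix X Y assume "X \<in> carrier (coxeter_group S M)" "Y \<in> carrier (coxeter_group S M)"
  then obtain u v where "u \<in> lists S" "v \<in> lists S" "X = word_class S M u" "Y = word_class S M v"
    by (elim coxeter_group_carrierE)
  then show "X \<otimes>\<^bsub>coxeter_group S M\<^esub> Y \<in> carrier (coxeter_group S M)"
    by (simp add: coxeter_group_mult word_class_carrier)
next
  show "\<one>\<^bsub>coxeter_group S M\<^esub> \<in> carrier (coxeter_group S M)"
    by (simp add: coxeter_group_one word_class_carrier)
next
  fix X Y Z
  assume "X \<in> carrier (coxeter_group S M)" "Y \<in> carrier (coxeter_group S M)"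
    "Z \<in> carrier (coxeter_group S M)"
  then obtain u v w where "u \<in> lists S" "v \<in> lists S" "w \<in> lists S"
    "X = word_class S M u" "Y = word_class S M v" "Z = word_class S M w"
    by (elim coxeter_group_carrierE)
  then show "X \<otimes>\<^bsub>coxeter_group S M\<^esub> Y \<otimes>\<^bsub>coxeter_group S M\<^esub> Z
      = X \<otimes>\<^bsub>coxeter_group S M\<^esub> (Y \<otimes>\<^bsub>coxeter_group S M\<^esub> Z)"
    by (simp add: coxeter_group_mult)
next
  fix X assume "X \<in> carrier (coxeter_group S M)"
  then obtain u where u: "u \<in> lists S" "X = word_class S M u" by (rule coxeter_group_carrierE)
  then show "\<one>\<^bsub>coxeter_group S M\<^esub> \<otimes>\<^bsub>coxeter_group S M\<^esub> X = X"
    by (simp add: coxeter_group_one coxeter_group_mult)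
  have "rev u \<in> lists S" using u by (auto simp: in_lists_conv_set)
  moreover have "word_class S M (rev u @ u) = word_class S M []"
    using word_class_eq_iff[of "rev u @ u" S "[]" M] coxeter_rel_rev[of S M, OF assms u(1)]
      u(1) \<open>rev u \<in> lists S\<close> by simp
  ultimately show "\<exists>Y\<in>carrier (coxeter_group S M).
      Y \<otimes>\<^bsub>coxeter_group S M\<^esub> X = \<one>\<^bsub>coxeter_group S M\<^esub>"
    using u by (intro bexI[of _ "word_class S M (rev u)"])
      (simp_all add: coxeter_group_one coxeter_group_mult word_class_carrier)
qed

lemma word_prod_Nil [simp]: "word_prod G [] = \<one>\<^bsub>G\<^esub>"
  by (simp add: word_prod_def)

lemma word_prod_Cons [simp]: "word_prod G (x # xs) = x \<otimes>\<^bsub>G\<^esub> word_prod G xs"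
  by (simp add: word_prod_def)

context monoid
begin

lemma word_prod_closed [simp, intro]: "set xs \<subseteq> carrier G \<Longrightarrow> word_prod G xs \<in> carrier G"
  by (induction xs) auto

lemma word_prod_append:
  "set xs \<subseteq> carrier G \<Longrightarrow> set ys \<subseteq> carrier G \<Longrightarrow>
    word_prod G (xs @ ys) = word_prod G xs \<otimes> word_prod G ys"
  by (induction xs) (auto simp: m_assoc)

lemma word_prod_replicate:
  "x \<in> carrier G \<Longrightarrow> y \<in> carrier G \<Longrightarrow>
    word_prod G (concat (replicate k [x, y])) = (x \<otimes> y) [^] k"
proof (induction k)
  case (Suc k)
  then have "word_prod G (concat (replicate (Suc k) [x, y])) = x \<otimes> (y \<otimes> (x \<otimes> y) [^] k)"
    by simp
  also have "\<dots> = (x \<otimes> y) \<otimes> (x \<otimes> y) [^] k"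
    using Suc.prems by (simp only: m_assoc nat_pow_closed m_closed)
  also have "\<dots> = (x \<otimes> y) [^] Suc k"
    using Suc.prems by (simp only: nat_pow_Suc2 m_closed)
  finally show ?case .
qed simp

end

text \<open>The universal property of the presentation.\<close>

lemma word_prod_coxeter_rel:
  assumes "group G" and f: "\<And>s. s \<in> S \<Longrightarrow> f s \<in> carrier G"
    and rel: "\<And>s t. s \<in> S \<Longrightarrow> t \<in> S \<Longrightarrow> (f s \<otimes>\<^bsub>G\<^esub> f t) [^]\<^bsub>G\<^esub> M s t = \<one>\<^bsub>G\<^esub>"
    and uv: "(u, v) \<in> coxeter_rel S M"
  shows "word_prod G (map f u) = word_prod G (map f v)"
proof -
  interpret group G by fact
  show ?thesis using uv
  proof induction
    case (rel s t u v)
    have 1: "set (map f u) \<subseteq> carrier G" "set (map f v) \<subseteq> carrier G"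
      using rel f by (auto simp: in_lists_conv_set)
    have 2: "map f (concat (replicate (M s t) [s, t])) = concat (replicate (M s t) [f s, f t])"
      by (simp add: map_concat)
    have 3: "set (concat (replicate (M s t) [f s, f t])) \<subseteq> carrier G"
      using rel f by auto
    show ?case
      using 1 3 rel f assms(3)[of s t]
      by (simp only: map_append 2 word_prod_append append_in_lists_conv set_append Un_subset_iff
          word_prod_replicate word_prod_closed l_one simp_thms)
  qed auto
qed

lemma group_affA: "group (affA N)"
  unfolding affA_def by (rule group_coxeter_group) (simp add: affA_matrix_def)

lemma gen_carrier: "1 \<le> k \<Longrightarrow> k \<le> N + 1 \<Longrightarrow> gen N k \<in> carrier (affA N)"
  unfolding gen_def affA_def by (rule word_class_carrier) simp

lemma word_prod_gen:
  assumes "u \<in> lists {1..N + 1}"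
  shows "word_prod (affA N) (map (gen N) u) = word_class {1..N + 1} (affA_matrix N) u"
  using assms
proof (induction u)
  case Nil
  then show ?case by (simp add: affA_def coxeter_group_one)
next
  case (Cons k u)
  then show ?case
    using coxeter_group_mult[of "[k]" "{1..N + 1}" u "affA_matrix N"]
    by (simp add: affA_def gen_def)
qed

lemma gen_relation:
  assumes "s \<in> {1..N + 1}" "t \<in> {1..N + 1}"
  shows "(gen N s \<otimes>\<^bsub>affA N\<^esub> gen N t) [^]\<^bsub>affA N\<^esub> affA_matrix N s t = \<one>\<^bsub>affA N\<^esub>"
proof -
  interpret group "affA N" by (rule group_affA)
  let ?w = "concat (replicate (affA_matrix N s t) [s, t])"
  have w: "?w \<in> lists {1..N + 1}" using assms by (auto simp: in_lists_conv_set)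
  have "(?w, []) \<in> coxeter_rel {1..N + 1} (affA_matrix N)"
    using coxeter_rel.rel[of s "{1..N + 1}" t "affA_matrix N" "[]" "[]"] assms
    by (simp add: affA_matrix_def)
  then have "word_class {1..N + 1} (affA_matrix N) ?w = word_class {1..N + 1} (affA_matrix N) []"
    using word_class_eq_iff[OF w] by simp
  then have "word_prod (affA N) (map (gen N) ?w) = \<one>\<^bsub>affA N\<^esub>"
    using word_prod_gen[OF w] by (simp add: affA_def coxeter_group_one)
  then show ?thesis
    using word_prod_replicate[of "gen N s" "gen N t"] gen_carrier assms by (simp add: map_concat)
qed


context group
begin

lemma involution_inv:
  assumes "x \<in> carrier G" "x \<otimes> x = \<one>"
  shows "inv x = x"
  using assms inv_equality by blast

lemma mult_eq_one_iff:
  assumes "x \<in> carrier G" "y \<in> carrier G"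
  shows "x \<otimes> y = \<one> \<longleftrightarrow> x = inv y"
  using inv_equality[of x y] l_inv[of y] assms by auto

lemma involution_cancel:
  assumes "x \<in> carrier G" "x \<otimes> x = \<one>" "z \<in> carrier G"
  shows "x \<otimes> (x \<otimes> z) = z"
  using assms by (simp flip: m_assoc)

lemma involutions_pow2_iff:
  assumes x: "x \<in> carrier G" "x \<otimes> x = \<one>" and y: "y \<in> carrier G" "y \<otimes> y = \<one>"
  shows "(x \<otimes> y) [^] (2::nat) = \<one> \<longleftrightarrow> x \<otimes> y = y \<otimes> x"
proof -
  have "(x \<otimes> y) [^] (2::nat) = (x \<otimes> y) \<otimes> (x \<otimes> y)"
    using x y by (simp add: numeral_2_eq_2)
  also have "\<dots> = \<one> \<longleftrightarrow> x \<otimes> y = inv (x \<otimes> y)"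
    using x y by (intro mult_eq_one_iff) simp_all
  also have "inv (x \<otimes> y) = y \<otimes> x"
    using x y by (simp add: inv_mult_group involution_inv)
  finally show ?thesis .
qed

lemma involutions_pow3_iff:
  assumes x: "x \<in> carrier G" "x \<otimes> x = \<one>" and y: "y \<in> carrier G" "y \<otimes> y = \<one>"
  shows "(x \<otimes> y) [^] (3::nat) = \<one> \<longleftrightarrow> x \<otimes> y \<otimes> x = y \<otimes> x \<otimes> y"
proof -
  have "(x \<otimes> y) [^] (3::nat) = (x \<otimes> y \<otimes> x) \<otimes> (y \<otimes> x \<otimes> y)"
    using x y by (simp add: numeral_3_eq_3 m_assoc)
  also have "\<dots> = \<one> \<longleftrightarrow> x \<otimes> y \<otimes> x = inv (y \<otimes> x \<otimes> y)"
    using x y by (intro mult_eq_one_iff) simp_all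
  also have "inv (y \<otimes> x \<otimes> y) = y \<otimes> x \<otimes> y"
    using x y by (simp add: inv_mult_group involution_inv m_assoc)
  finally show ?thesis .
qed

lemma braid_conjugate:
  assumes p: "p \<in> carrier G" "p \<otimes> p = \<one>" and q: "q \<in> carrier G" "q \<otimes> q = \<one>"
    and s: "s \<in> carrier G" "s \<otimes> s = \<one>"
    and comm: "s \<otimes> p = p \<otimes> s" and braid: "s \<otimes> q \<otimes> s = q \<otimes> s \<otimes> q"
  shows "s \<otimes> (p \<otimes> q \<otimes> p) \<otimes> s = (p \<otimes> q \<otimes> p) \<otimes> s \<otimes> (p \<otimes> q \<otimes> p)"
proof -
  have c: "s \<otimes> (p \<otimes> z) = p \<otimes> (s \<otimes> z)" if "z \<in> carrier G" for z
    using comm m_assoc[of s p z] m_assoc[of p s z] p s that by simp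
  have b: "s \<otimes> (q \<otimes> (s \<otimes> z)) = q \<otimes> (s \<otimes> (q \<otimes> z))" if "z \<in> carrier G" for z
  proof -
    have "s \<otimes> q \<otimes> s \<otimes> z = q \<otimes> s \<otimes> q \<otimes> z" using braid by simp
    then show ?thesis using q s that by (simp add: m_assoc)
  qed
  have "s \<otimes> (p \<otimes> q \<otimes> p) \<otimes> s = p \<otimes> (s \<otimes> (q \<otimes> (s \<otimes> p)))"
    using p q s comm by (simp add: m_assoc c)
  also have "\<dots> = p \<otimes> (q \<otimes> (s \<otimes> (q \<otimes> p)))"
    using p by (simp add: b)
  also have "\<dots> = (p \<otimes> q \<otimes> p) \<otimes> s \<otimes> (p \<otimes> q \<otimes> p)"
    using p q s by (simp add: m_assoc c involution_cancel)
  finally show ?thesis .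
qed

end

lemma R_gen_carrier:
  assumes "k \<in> {1..n}"
  shows "R_gen n k \<in> carrier (affA n)"
proof -
  interpret group "affA n" by (rule group_affA)
  show ?thesis using assms gen_carrier by (auto simp: R_gen_def)
qed

lemma R_gen_relation:
  assumes n: "n \<ge> 3" and st: "s \<in> {1..n}" "t \<in> {1..n}"
  shows "(R_gen n s \<otimes>\<^bsub>affA n\<^esub> R_gen n t) [^]\<^bsub>affA n\<^esub> affA_matrix (n - 1) s t = \<one>\<^bsub>affA n\<^esub>"
proof -
  interpret group "affA n" by (rule group_affA)
  let ?g = "gen n" and ?b = "R_gen n n"
  have g [simp]: "?g k \<in> carrier (affA n)" if "k \<in> {1..n + 1}" for k
    using gen_carrier that by simp
  have inv [simp]: "?g k \<otimes>\<^bsub>affA n\<^esub> ?g k = \<one>\<^bsub>affA n\<^esub>" if "k \<in> {1..n + 1}" for k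
    using gen_relation[of k n k] that by (simp add: affA_matrix_def)
  have comm: "?g k \<otimes>\<^bsub>affA n\<^esub> ?g l = ?g l \<otimes>\<^bsub>affA n\<^esub> ?g k"
    if "k \<in> {1..n + 1}" "l \<in> {1..n + 1}" "affA_matrix n k l = 2" for k l
    using gen_relation[of k n l] involutions_pow2_iff[of "?g k" "?g l"] that by simp
  have braid: "?g k \<otimes>\<^bsub>affA n\<^esub> ?g l \<otimes>\<^bsub>affA n\<^esub> ?g k = ?g l \<otimes>\<^bsub>affA n\<^esub> ?g k \<otimes>\<^bsub>affA n\<^esub> ?g l"
    if "k \<in> {1..n + 1}" "l \<in> {1..n + 1}" "affA_matrix n k l = 3" for k l
    using gen_relation[of k n l] involutions_pow3_iff[of "?g k" "?g l"] that by simp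
  have b: "?b = ?g n \<otimes>\<^bsub>affA n\<^esub> ?g (n + 1) \<otimes>\<^bsub>affA n\<^esub> ?g n" by (simp add: R_gen_def)
  have b': "?b = ?g (n + 1) \<otimes>\<^bsub>affA n\<^esub> ?g n \<otimes>\<^bsub>affA n\<^esub> ?g (n + 1)"
    unfolding b by (rule braid) (use n in \<open>auto simp: affA_matrix_def\<close>)
  have bc: "?b \<in> carrier (affA n)" using R_gen_carrier n by simp
  have bb: "?b \<otimes>\<^bsub>affA n\<^esub> ?b = \<one>\<^bsub>affA n\<^esub>"
    unfolding b using n by (simp add: m_assoc involution_cancel)
  have b_braid: "?g k \<otimes>\<^bsub>affA n\<^esub> ?b \<otimes>\<^bsub>affA n\<^esub> ?g k = ?b \<otimes>\<^bsub>affA n\<^esub> ?g k \<otimes>\<^bsub>affA n\<^esub> ?b"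
    if "k = 1 \<or> k = n - 1" for k
    using that
  proof
    assume k: "k = 1"
    have c: "?g k \<otimes>\<^bsub>affA n\<^esub> ?g (n) = ?g (n) \<otimes>\<^bsub>affA n\<^esub> ?g k"
      by (rule comm) (use n k in \<open>auto simp: affA_matrix_def doubleton_eq_iff\<close>)
    have d: "?g k \<otimes>\<^bsub>affA n\<^esub> ?g (n + 1) \<otimes>\<^bsub>affA n\<^esub> ?g k
        = ?g (n + 1) \<otimes>\<^bsub>affA n\<^esub> ?g k \<otimes>\<^bsub>affA n\<^esub> ?g (n + 1)"
      by (rule braid) (use n k in \<open>auto simp: affA_matrix_def\<close>)
    show ?thesis unfolding b
      by (rule braid_conjugate[OF _ _ _ _ _ _ c d]) (rule g inv; use n k in force)+
  next
    assume k: "k = n - 1"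
    have c: "?g k \<otimes>\<^bsub>affA n\<^esub> ?g (n + 1) = ?g (n + 1) \<otimes>\<^bsub>affA n\<^esub> ?g k"
      by (rule comm) (use n k in \<open>auto simp: affA_matrix_def doubleton_eq_iff\<close>)
    have d: "?g k \<otimes>\<^bsub>affA n\<^esub> ?g (n) \<otimes>\<^bsub>affA n\<^esub> ?g k
        = ?g (n) \<otimes>\<^bsub>affA n\<^esub> ?g k \<otimes>\<^bsub>affA n\<^esub> ?g (n)"
      by (rule braid) (use n k in \<open>auto simp: affA_matrix_def\<close>)
    show ?thesis unfolding b'
      by (rule braid_conjugate[OF _ _ _ _ _ _ c d]) (rule g inv; use n k in force)+
  qed
  have b_comm: "?g k \<otimes>\<^bsub>affA n\<^esub> ?b = ?b \<otimes>\<^bsub>affA n\<^esub> ?g k" if k: "1 < k" "k < n - 1" for k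
  proof -
    have c1: "?g k \<otimes>\<^bsub>affA n\<^esub> ?g n = ?g n \<otimes>\<^bsub>affA n\<^esub> ?g k"
      by (rule comm) (use k in \<open>auto simp: affA_matrix_def doubleton_eq_iff\<close>)
    have c2: "?g k \<otimes>\<^bsub>affA n\<^esub> ?g (n + 1) = ?g (n + 1) \<otimes>\<^bsub>affA n\<^esub> ?g k"
      by (rule comm) (use k in \<open>auto simp: affA_matrix_def doubleton_eq_iff\<close>)
    have gs: "?g k \<in> carrier (affA n)" "?g n \<in> carrier (affA n)" "?g (n + 1) \<in> carrier (affA n)"
      using k by auto
    show ?thesis unfolding b 
      using gs c1 c2 m_assoc[of "?g n" "?g k" "?g (n + 1) \<otimes>\<^bsub>affA n\<^esub> ?g n"]
        m_assoc[of "?g k" "?g n" "?g (n + 1) \<otimes>\<^bsub>affA n\<^esub> ?g n"]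
        m_assoc[of "?g k" "?g (n + 1)" "?g n"] m_assoc[of "?g (n + 1)" "?g k" "?g n"]
      by (simp add: m_assoc)
  qed
  consider "s < n" "t < n" | "s = n" "t = n" | "s < n" "t = n" | "s = n" "t < n"
    using st by force
  then show ?thesis
  proof cases
    case 1
    then have "affA_matrix (n - 1) s t = affA_matrix n s t"
      using n by (auto simp: affA_matrix_def doubleton_eq_iff)
    then show ?thesis using 1 st gen_relation[of s n t] by (simp add: R_gen_def)
  next
    case 2
    then show ?thesis using bb bc by (simp add: affA_matrix_def)
  next
    case 3
    then have s: "R_gen n s = ?g s" "s \<in> {1..n + 1}" using st by (auto simp: R_gen_def)
    show ?thesis
    proof (cases "s = 1 \<or> s = n - 1")
      case True
      then have "affA_matrix (n - 1) s t = 3" using 3 n by (auto simp: affA_matrix_def)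
      then show ?thesis using involutions_pow3_iff[of "?g s" ?b] b_braid[OF True] s bb bc 3 by simp
    next
      case False
      then have "affA_matrix (n - 1) s t = 2" and *: "1 < s" "s < n - 1"
        using 3 n st by (auto simp: affA_matrix_def doubleton_eq_iff)
      then show ?thesis using involutions_pow2_iff[of "?g s" ?b] b_comm[OF *] s bb bc 3 by simp
    qed
  next
    case 4
    then have t: "R_gen n t = ?g t" "t \<in> {1..n + 1}" using st by (auto simp: R_gen_def)
    show ?thesis
    proof (cases "t = 1 \<or> t = n - 1")
      case True
      then have "affA_matrix (n - 1) s t = 3" using 4 n by (auto simp: affA_matrix_def)
      then show ?thesis using involutions_pow3_iff[of ?b "?g t"] b_braid[OF True] t bb bc 4 by simp
    next
      case False
      then have "affA_matrix (n - 1) s t = 2" and *: "1 < t" "t < n - 1"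
        using 4 n st by (auto simp: affA_matrix_def doubleton_eq_iff)
      then show ?thesis using involutions_pow2_iff[of ?b "?g t"] b_comm[OF *] t bb bc 4 by simp
    qed
  qed
qed

lemma R_word_class:
  assumes n: "n \<ge> 3" and u: "u \<in> lists {1..n}"
  shows "R n (word_class {1..n} (affA_matrix (n - 1)) u) = word_prod (affA n) (map (R_gen n) u)"
proof -
  have "word_prod (affA n) (map (R_gen n) v) = word_prod (affA n) (map (R_gen n) u)"
    if "v \<in> word_class {1..n} (affA_matrix (n - 1)) u" for v
  proof (rule word_prod_coxeter_rel[OF group_affA R_gen_carrier R_gen_relation[OF n]])
    show "(v, u) \<in> coxeter_rel {1..n} (affA_matrix (n - 1))"
      using that by (auto simp: word_class_def intro: coxeter_rel.sym)
  qed
  then have "(\<lambda>v. word_prod (affA n) (map (R_gen n) v)) `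
      word_class {1..n} (affA_matrix (n - 1)) u = {word_prod (affA n) (map (R_gen n) u)}"
    using word_class_self[OF u] by fast
  then show ?thesis by (simp add: R_def)
qed

lemma R_hom:
  assumes n: "n \<ge> 3"
  shows "R n \<in> hom (affA (n - 1)) (affA n)"
proof -
  interpret group "affA n" by (rule group_affA)
  have eq: "affA (n - 1) = coxeter_group {1..n} (affA_matrix (n - 1))"
    using n by (simp add: affA_def)
  have car: "set (map (R_gen n) u) \<subseteq> carrier (affA n)" if "u \<in> lists {1..n}" for u
    using that R_gen_carrier by (auto simp: in_lists_conv_set)
  show ?thesis
  proof (rule homI)
    fix X assume "X \<in> carrier (affA (n - 1))"
    then obtain u where u: "u \<in> lists {1..n}" "X = word_class {1..n} (affA_matrix (n - 1)) u"
      unfolding eq by (rule coxeter_group_carrierE)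
    then show "R n X \<in> carrier (affA n)"
      using word_prod_closed[OF car[OF u(1)]] by (simp only: R_word_class[OF n])
  next
    fix X Y assume X: "X \<in> carrier (affA (n - 1))" and Y: "Y \<in> carrier (affA (n - 1))"
    from X obtain u where u: "u \<in> lists {1..n}" "X = word_class {1..n} (affA_matrix (n - 1)) u"
      unfolding eq by (rule coxeter_group_carrierE)
    from Y obtain v where v: "v \<in> lists {1..n}" "Y = word_class {1..n} (affA_matrix (n - 1)) v"
      unfolding eq by (rule coxeter_group_carrierE)
    have uv: "u @ v \<in> lists {1..n}" using u v by simp
    show "R n (X \<otimes>\<^bsub>affA (n - 1)\<^esub> Y) = R n X \<otimes>\<^bsub>affA n\<^esub> R n Y"
      unfolding eq u(2) v(2) coxeter_group_mult[OF u(1) v(1)]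
      using word_prod_append[OF car[OF u(1)] car[OF v(1)]]
      by (simp only: R_word_class[OF n u(1)] R_word_class[OF n v(1)] R_word_class[OF n uv] map_append)
  qed
qed

lemma R_sigma:
  assumes "n \<ge> 3" "k \<in> {1..n - 1}"
  shows "R n (sigma (n - 1) k) = sigma n k"
proof -
  interpret group "affA n" by (rule group_affA)
  have "[k] \<in> lists {1..n}" "k \<noteq> n" using assms by auto
  moreover have "gen (n - 1) k = word_class {1..n} (affA_matrix (n - 1)) [k]"
    using assms by (simp add: gen_def)
  ultimately show ?thesis
    using R_word_class[OF assms(1), of "[k]"] assms gen_carrier[of k n]
    by (simp add: R_gen_def)
qed

lemma R_aff:
  assumes "n \<ge> 3"
  shows "R n (aff (n - 1)) = sigma n n \<otimes>\<^bsub>affA n\<^esub> aff n \<otimes>\<^bsub>affA n\<^esub> sigma n n"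
proof -
  interpret group "affA n" by (rule group_affA)
  have "[n] \<in> lists {1..n}" using assms by auto
  moreover have "gen (n - 1) (n - 1 + 1) = word_class {1..n} (affA_matrix (n - 1)) [n]"
    using assms by (simp add: gen_def)
  ultimately show ?thesis
    using R_word_class[OF assms, of "[n]"] assms R_gen_carrier[of n n]
    by (simp add: R_gen_def)
qed

end

theory Submission
  imports Defs
begin

text \<open>
  The group acts on the integers as affine permutations of period \<open>n + 1\<close>, and \<open>R\<close> identifies
  the smaller group with the stabilizer of \<open>n + 1\<close>: the elements
  \<open>\<lfloor>r,n\<rfloor> T\<^sup>k\<close> with \<open>T = a\<^bsub>n+1\<^esub> \<lfloor>1,n\<rfloor>\<close> represent all its cosets, since \<open>T\<close> normalizes the image of \<open>R\<close>,
  and they move \<open>n + 1\<close> to pairwise different points.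
  Hence one has to follow \<open>n + 1\<close> through the factors of the canonical form, starting from the
  left, against their action. As long as \<open>i\<^sub>k < n - k\<close> it descends by one per factor; at the first
  index where this fails it either stays put for good, or leaves its period, and the pairwise
  inequalities prevent it from ever coming back. The point reached at the end must be the image of
  \<open>n + 1\<close> under \<open>x\<close>, which determines the coset of \<open>x\<close> modulo \<open>W(A\<^bsub>n-1\<^esub>)\<close>.
\<close>

section \<open>The action on the integers\<close>

text \<open>The pair \<open>(c, r)\<close> with \<open>1 \<le> r \<le> n + 1\<close> stands for the integer \<open>r + c (n + 1)\<close>.\<close>

fun gen_step :: "nat \<Rightarrow> nat \<Rightarrow> int \<times> nat \<Rightarrow> int \<times> nat" where
  "gen_step n k (c, r) =
    (if k = n + 1 then
       (if r = n + 1 then (c + 1, 1) else if r = 1 then (c - 1, n + 1) else (c, r))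
     else (if r = k then (c, k + 1) else if r = k + 1 then (c, k) else (c, r)))"

definition act_word :: "nat \<Rightarrow> nat list \<Rightarrow> int \<times> nat \<Rightarrow> int \<times> nat" where
  "act_word n u = foldr (gen_step n) u"

lemma act_word_simps [simp]:
  "act_word n [] p = p"
  "act_word n (k # u) p = gen_step n k (act_word n u p)"
  "act_word n (u @ v) p = act_word n u (act_word n v p)"
  by (simp_all add: act_word_def)

section \<open>The Coxeter relations for the steps on the integers\<close>

lemma gen_step_involution:
  assumes "n \<ge> 1"
  shows "gen_step n s (gen_step n s p) = p"
  using assms by (cases p) simp

text \<open>Each step exchanges two adjacent residues modulo \<open>n + 1\<close>, and two
  neighbouring generators of the cycle share exactly one residue. Every edge is listed in one
  direction only.\<close>

lemma gen_step_braid: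
  assumes "n \<ge> 2" "1 \<le> s \<and> s < n \<and> t = s + 1 \<or> s = n \<and> t = n + 1 \<or> s = n + 1 \<and> t = 1"
  shows "gen_step n s (gen_step n t (gen_step n s p)) = gen_step n t (gen_step n s (gen_step n t p))"
proof -
  obtain c r where p: "p = (c, r)" by force
  from assms(2) show ?thesis
  proof (elim disjE conjE)
    assume "1 \<le> s" "s < n" "t = s + 1"
    then show ?thesis unfolding p by (cases "r = s"; cases "r = s + 1"; cases "r = s + 2") simp_all
  next
    assume "s = n" "t = n + 1"
    then show ?thesis using assms(1) unfolding p
      by (cases "r = n"; cases "r = n + 1"; cases "r = 1") simp_all
  next
    assume "s = n + 1" "t = 1"
    then show ?thesis using assms(1) unfolding p
      by (cases "r = 2"; cases "r = n + 1"; cases "r = 1") simp_all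
  qed
qed

lemma gen_step_commute:
  assumes "n \<ge> 2" "s \<in> {1..n + 1}" "t \<in> {1..n + 1}"
    and "s \<noteq> t" "t \<noteq> s + 1" "s \<noteq> t + 1" "{s, t} \<noteq> {1, n + 1}"
  shows "gen_step n s (gen_step n t p) = gen_step n t (gen_step n s p)"
  using assms by (cases p) (auto simp: doubleton_eq_iff)

lemma gen_step_relation:
  assumes "n \<ge> 2" "s \<in> {1..n + 1}" "t \<in> {1..n + 1}"
  shows "act_word n (concat (replicate (affA_matrix n s t) [s, t])) p = p"
proof -
  have rep: "concat (replicate 2 [s, t]) = [s, t, s, t]"
    "concat (replicate 3 [s, t]) = [s, t, s, t, s, t]"
    by (simp_all add: numeral_2_eq_2 numeral_3_eq_3)
  have sq: "gen_step n k (gen_step n k q) = q" for k q using assms(1) by (simp add: gen_step_involution)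
  consider "s = t" | "s \<noteq> t" "t = s + 1 \<or> s = t + 1 \<or> {s, t} = {1, n + 1}"
    | "s \<noteq> t" "t \<noteq> s + 1" "s \<noteq> t + 1" "{s, t} \<noteq> {1, n + 1}"
    by blast
  then show ?thesis
  proof cases
    case 1
    then show ?thesis by (simp add: affA_matrix_def sq)
  next
    case 2
    then have M: "affA_matrix n s t = 3" by (simp add: affA_matrix_def)
    \<comment> \<open>Every edge of the cycle, read in one of its two directions, has the form that
      \<open>gen_step_braid\<close> expects.\<close>
    have "1 \<le> k \<and> k < n \<and> l = k + 1 \<or> k = n \<and> l = n + 1 \<or> k = n + 1 \<and> l = 1"
      if "{k, l} = {1, n + 1} \<and> k \<noteq> 1 \<or> l = k + 1" "1 \<le> k" "l \<le> n + 1" for k l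
      using that by (auto simp: doubleton_eq_iff)
    from this[of s t] this[of t s] have
      "1 \<le> s \<and> s < n \<and> t = s + 1 \<or> s = n \<and> t = n + 1 \<or> s = n + 1 \<and> t = 1 \<or>
       1 \<le> t \<and> t < n \<and> s = t + 1 \<or> t = n \<and> s = n + 1 \<or> t = n + 1 \<and> s = 1"
      using 2 assms by (auto simp: insert_commute)
    then have "gen_step n s (gen_step n t (gen_step n s q)) = gen_step n t (gen_step n s (gen_step n t q))" for q
      using gen_step_braid[OF assms(1), of s t q] gen_step_braid[OF assms(1), of t s q] by metis
    then show ?thesis unfolding M rep by (simp add: sq del: gen_step.simps)
  next
    case 3
    then have M: "affA_matrix n s t = 2" by (simp add: affA_matrix_def)
    show ?thesis using gen_step_commute[OF assms 3] unfolding M rep by (simp add: sq)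
  qed
qed

lemma act_word_coxeter_rel:
  assumes "(u, v) \<in> coxeter_rel {1..n + 1} (affA_matrix n)" "n \<ge> 2"
  shows "act_word n u p = act_word n v p"
  using assms(1)
proof (induction arbitrary: p)
  case (rel s t u v)
  then show ?case using gen_step_relation[OF assms(2)] by simp
qed simp_all

section \<open>The action of group elements\<close>

definition act :: "nat \<Rightarrow> nat list set \<Rightarrow> int \<times> nat \<Rightarrow> int \<times> nat" where
  "act n w = act_word n (SOME u. u \<in> w)"

text \<open>Equivalent words act alike because the steps satisfy the Coxeter relations, so the word
  picked by \<open>SOME\<close> is irrelevant.\<close>

lemma act_word_class:
  assumes "n \<ge> 2" "u \<in> lists {1..n + 1}"
  shows "act n (word_class {1..n + 1} (affA_matrix n) u) = act_word n u"
proof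
  fix p
  let ?W = "word_class {1..n + 1} (affA_matrix n) u"
  have "(SOME v. v \<in> ?W) \<in> ?W"
    using word_class_self[OF assms(2)] by (rule someI)
  then have "(u, SOME v. v \<in> ?W) \<in> coxeter_rel {1..n + 1} (affA_matrix n)"
    by (simp add: word_class_def)
  from act_word_coxeter_rel[OF this assms(1)] show "act n ?W p = act_word n u p"
    by (simp add: act_def)
qed

lemma affA_carrierE:
  assumes "w \<in> carrier (affA n)"
  obtains u where "u \<in> lists {1..n + 1}" "w = word_class {1..n + 1} (affA_matrix n) u"
  using assms unfolding affA_def by (rule coxeter_group_carrierE)

lemma act_mult:
  assumes "n \<ge> 2" "v \<in> carrier (affA n)" "w \<in> carrier (affA n)"
  shows "act n (v \<otimes>\<^bsub>affA n\<^esub> w) p = act n v (act n w p)"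
proof -
  obtain s where s: "s \<in> lists {1..n + 1}" "v = word_class {1..n + 1} (affA_matrix n) s"
    using assms(2) by (rule affA_carrierE)
  obtain t where t: "t \<in> lists {1..n + 1}" "w = word_class {1..n + 1} (affA_matrix n) t"
    using assms(3) by (rule affA_carrierE)
  have "s @ t \<in> lists {1..n + 1}" using s(1) t(1) by simp
  moreover have "v \<otimes>\<^bsub>affA n\<^esub> w = word_class {1..n + 1} (affA_matrix n) (s @ t)"
    unfolding s(2) t(2) affA_def by (rule coxeter_group_mult[OF s(1) t(1)])
  ultimately show ?thesis
    using act_word_class[OF assms(1)] s t by simp
qed

lemma act_one: "n \<ge> 2 \<Longrightarrow> act n \<one>\<^bsub>affA n\<^esub> p = p"
  using act_word_class[of n "[]"] by (simp add: affA_def coxeter_group_one)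

lemma act_gen: "n \<ge> 2 \<Longrightarrow> 1 \<le> k \<Longrightarrow> k \<le> n + 1 \<Longrightarrow> act n (gen n k) p = gen_step n k p"
  using act_word_class[of n "[k]"] by (simp add: gen_def)

lemma act_word_prod:
  assumes "n \<ge> 2" "\<And>s. s \<in> set xs \<Longrightarrow> f s \<in> carrier (affA n)"
  shows "act n (word_prod (affA n) (map f xs)) p = foldr (\<lambda>s. act n (f s)) xs p"
proof -
  interpret group "affA n" by (rule group_affA)
  show ?thesis using assms(2)
  proof (induction xs)
    case (Cons s xs)
    then have "set (map f xs) \<subseteq> carrier (affA n)" by auto
    with Cons show ?case by (simp add: act_mult[OF assms(1)] word_prod_closed)
  qed (simp add: act_one[OF assms(1)])
qed

section \<open>The factors of a canonical form and their action\<close>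

lemma asc_carrier [simp]:
  assumes "1 \<le> r"
  shows "asc n r n \<in> carrier (affA n)"
proof -
  interpret group "affA n" by (rule group_affA)
  show ?thesis unfolding asc_def using assms by (auto intro!: word_prod_closed gen_carrier)
qed

lemma asc_top: "asc n (n + 1) n = \<one>\<^bsub>affA n\<^esub>"
  by (simp add: asc_def)

lemma asc_step:
  assumes "r \<le> n"
  shows "asc n r n = gen n r \<otimes>\<^bsub>affA n\<^esub> asc n (r + 1) n"
  using assms upt_conv_Cons[of r "n + 1"] by (simp add: asc_def)

lemma dsc_carrier [simp]:
  assumes "i \<le> n"
  shows "dsc n i 1 \<in> carrier (affA n)"
proof -
  interpret group "affA n" by (rule group_affA)
  show ?thesis unfolding dsc_def using assms by (intro word_prod_closed) (auto intro!: gen_carrier)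
qed

lemma dsc_step: "dsc n (Suc i) 1 = gen n (Suc i) \<otimes>\<^bsub>affA n\<^esub> dsc n i 1"
  by (simp add: dsc_def)

lemma act_asc:
  assumes "n \<ge> 2" "1 \<le> r" "r \<le> n + 1" "q \<le> n + 1"
  shows "act n (asc n r n) (c, q) = (c, if q = n + 1 then r else if r \<le> q then q + 1 else q)"
  using assms(3,2)
proof (induction r rule: inc_induct)
  case base
  then show ?case using assms using asc_top[of n] by (simp add: act_one)
next
  case (step r)
  then have "act n (asc n r n) (c, q) = gen_step n r (act n (asc n (Suc r) n) (c, q))"
    using assms(1) by (simp add: asc_step act_mult gen_carrier act_gen)
  then show ?case using step assms(4) by auto
qed

lemma act_dsc:
  assumes "n \<ge> 2" "i \<le> n" "1 \<le> q"
  shows "act n (dsc n i 1) (c, q) = (c, if q = 1 then i + 1 else if q \<le> i + 1 then q - 1 else q)"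
  using assms(2)
proof (induction i)
  case 0
  then show ?case using assms by (simp add: dsc_def act_one)
next
  case (Suc i)
  then have "act n (dsc n (Suc i) 1) (c, q) = gen_step n (Suc i) (act n (dsc n i 1) (c, q))"
    using assms(1) by (simp add: dsc_step act_mult gen_carrier act_gen del: One_nat_def)
  then show ?case using Suc assms(3) by auto
qed

text \<open>This is the action of one factor: first \<open>aff n\<close> carries
  \<open>n + 1\<close> or \<open>1\<close> across a period boundary, then the descending product
  cycles \<open>1, ..., i + 1\<close> downwards, then the ascending one cycles
  \<open>j, ..., n + 1\<close> upwards.\<close>

fun factor_step :: "nat \<Rightarrow> nat \<Rightarrow> nat \<Rightarrow> int \<times> nat \<Rightarrow> int \<times> nat" where
  "factor_step n j i (c, q) =
    (if q = n + 1 then (c + 1, if j \<le> i + 1 then i + 2 else i + 1)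
     else if q = 1 then (c - 1, j)
     else if q \<le> i + 1 then (c, if j \<le> q - 1 then q else q - 1)
     else (c, if j \<le> q then q + 1 else q))"

lemma hh_carrier:
  assumes "1 \<le> j" "i \<le> n"
  shows "hh n j i \<in> carrier (affA n)"
proof -
  interpret group "affA n" by (rule group_affA)
  show ?thesis using assms by (simp add: hh_def del: One_nat_def)
qed

lemma act_factor:
  assumes "n \<ge> 2" "1 \<le> j" "j \<le> n + 1" "i \<le> n - 1" "1 \<le> q" "q \<le> n + 1"
  shows "act n (hh n j i \<otimes>\<^bsub>affA n\<^esub> aff n) (c, q) = factor_step n j i (c, q)"
proof -
  have i: "i \<le> n" using assms by simp
  have "act n (hh n j i \<otimes>\<^bsub>affA n\<^esub> aff n) (c, q)
      = act n (asc n j n) (act n (dsc n i 1) (gen_step n (n + 1) (c, q)))"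
    using assms i hh_carrier[of j i n]
    by (simp add: act_mult gen_carrier act_gen hh_def del: One_nat_def gen_step.simps)
  also have "\<dots> = factor_step n j i (c, q)"
    using assms act_dsc[of n i] act_asc[of n j] by auto
  finally show ?thesis .
qed

section \<open>The image of \<open>R\<close> as a stabilizer\<close>

text \<open>The generators are their own inverses, so inverses are again values of words.\<close>

lemma involutions_generate:
  assumes "group G" and f: "\<And>s. s \<in> S \<Longrightarrow> f s \<in> carrier G"
    and invol: "\<And>s. s \<in> S \<Longrightarrow> f s \<otimes>\<^bsub>G\<^esub> f s = \<one>\<^bsub>G\<^esub>"
  shows "generate G (f ` S) = (\<lambda>u. word_prod G (map f u)) ` lists S"
proof -
  interpret group G by fact
  have car: "set (map f u) \<subseteq> carrier G" if "u \<in> lists S" for u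
    using that f by (auto simp: in_lists_conv_set)
  have word: "\<exists>u\<in>lists S. x = word_prod G (map f u)" if "x \<in> generate G (f ` S)" for x
    using that
  proof induction
    case one
    then show ?case by (intro bexI[of _ "[]"]) auto
  next
    case (incl h)
    then obtain s where "s \<in> S" "h = f s" by auto
    then show ?case using f by (intro bexI[of _ "[s]"]) auto
  next
    case (inv h)
    then obtain s where "s \<in> S" "h = f s" by auto
    then show ?case using f invol by (intro bexI[of _ "[s]"]) (auto simp: involution_inv)
  next
    case (eng g h)
    then obtain u v where uv: "u \<in> lists S" "v \<in> lists S"
      "g = word_prod G (map f u)" "h = word_prod G (map f v)" by auto
    then show ?case
      using word_prod_append[OF car car] by (intro bexI[of _ "u @ v"]) auto
  qed
  have "word_prod G (map f u) \<in> generate G (f ` S)" if "u \<in> lists S" for u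
    using that
    by (induction u) (auto intro: generate.one generate.eng generate.incl)
  with word show ?thesis by blast
qed

context
  fixes n :: nat
  assumes n: "n \<ge> 3"
begin

interpretation group "affA n" by (rule group_affA)

abbreviation (input) mul (infixl "\<cdot>" 70) where "v \<cdot> w \<equiv> v \<otimes>\<^bsub>affA n\<^esub> w"
abbreviation (input) "g \<equiv> gen n"
abbreviation (input) "as r \<equiv> asc n r n"

section \<open>Moving generators through ascending products\<close>

lemma g_carrier [simp]: "1 \<le> k \<Longrightarrow> k \<le> n + 1 \<Longrightarrow> g k \<in> carrier (affA n)"
  by (rule gen_carrier)

lemma g_square: "1 \<le> k \<Longrightarrow> k \<le> n + 1 \<Longrightarrow> g k \<cdot> g k = \<one>\<^bsub>affA n\<^esub>"
  using gen_relation[of k n k] by (simp add: affA_matrix_def)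

lemma g_square_left:
  "1 \<le> k \<Longrightarrow> k \<le> n + 1 \<Longrightarrow> z \<in> carrier (affA n) \<Longrightarrow> g k \<cdot> (g k \<cdot> z) = z"
  by (intro involution_cancel g_square g_carrier)

lemma g_commute:
  assumes "1 \<le> k" "k + 1 < l" "l \<le> n + 1" "\<not> (k = 1 \<and> l = n + 1)"
  shows "g k \<cdot> g l = g l \<cdot> g k"
proof -
  have "affA_matrix n k l = 2" using assms by (auto simp: affA_matrix_def doubleton_eq_iff)
  then have "(g k \<cdot> g l) [^]\<^bsub>affA n\<^esub> (2::nat) = \<one>\<^bsub>affA n\<^esub>"
    using gen_relation[of k n l] assms by simp
  then show ?thesis
    by (subst (asm) involutions_pow2_iff) (use assms g_square in auto)
qed

lemma g_commute_left:
  assumes "1 \<le> k" "k + 1 < l" "l \<le> n + 1" "\<not> (k = 1 \<and> l = n + 1)" "z \<in> carrier (affA n)"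
  shows "g k \<cdot> (g l \<cdot> z) = g l \<cdot> (g k \<cdot> z)"
proof -
  have "g k \<in> carrier (affA n)" "g l \<in> carrier (affA n)" using assms by auto
  then show ?thesis
    using g_commute[OF assms(1-4)] assms(5) m_assoc[of "g k" "g l" z] m_assoc[of "g l" "g k" z] by simp
qed

lemma g_braid_left:
  assumes "1 \<le> k" "l = k + 1 \<or> k = 1 \<and> l = n + 1" "l \<le> n + 1" "z \<in> carrier (affA n)"
  shows "g k \<cdot> (g l \<cdot> (g k \<cdot> z)) = g l \<cdot> (g k \<cdot> (g l \<cdot> z))"
proof -
  have kl: "g k \<in> carrier (affA n)" "g l \<in> carrier (affA n)" using assms by auto
  have "affA_matrix n k l = 3" using assms(2) n by (elim disjE) (simp_all add: affA_matrix_def)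
  moreover have "k \<in> {1..n + 1}" "l \<in> {1..n + 1}" using assms by auto
  ultimately have "(g k \<cdot> g l) [^]\<^bsub>affA n\<^esub> (3::nat) = \<one>\<^bsub>affA n\<^esub>"
    using gen_relation[of k n l] by simp
  then have "g k \<cdot> g l \<cdot> g k = g l \<cdot> g k \<cdot> g l"
    by (subst (asm) involutions_pow3_iff) (use assms kl g_square in auto)
  then have "g k \<cdot> g l \<cdot> g k \<cdot> z = g l \<cdot> g k \<cdot> g l \<cdot> z" by simp
  then show ?thesis using kl assms(4) by (simp add: m_assoc)
qed

lemma g_asc_below:
  assumes "1 \<le> q" "q + 1 < r" "r \<le> n + 1"
  shows "g q \<cdot> as r = as r \<cdot> g q"
  using assms(3,2)
proof (induction r rule: inc_induct)
  case base
  then show ?case using assms asc_top[of n] by simp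
next
  case (step r)
  then have le: "r \<le> n" by simp
  have "g q \<cdot> as r = g r \<cdot> (g q \<cdot> as (r + 1))"
    unfolding asc_step[OF le] by (rule g_commute_left) (use step assms in auto)
  also have "\<dots> = g r \<cdot> (as (r + 1) \<cdot> g q)" using step by simp
  also have "\<dots> = as r \<cdot> g q" using step assms by (simp add: asc_step m_assoc)
  finally show ?case .
qed

text \<open>The braid relation is used once, where \<open>g (q + 1)\<close> meets the factor
  \<open>g q\<close>; all other factors commute with the generator that passes.\<close>

lemma g_asc_above:
  assumes "1 \<le> r" "r \<le> q" "q < n"
  shows "g (q + 1) \<cdot> as r = as r \<cdot> g q"
  using assms(2,1)
proof (induction r rule: inc_induct)
  case base
  have "g (q + 1) \<cdot> as q = g (q + 1) \<cdot> (g q \<cdot> (g (q + 1) \<cdot> as (q + 2)))"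
    using assms by (simp add: asc_step)
  also have "\<dots> = g q \<cdot> (g (q + 1) \<cdot> (g q \<cdot> as (q + 2)))"
    by (rule g_braid_left[symmetric]) (use assms in auto)
  also have "\<dots> = g q \<cdot> (g (q + 1) \<cdot> (as (q + 2) \<cdot> g q))"
    using assms g_asc_below[of q "q + 2"] by simp
  also have "\<dots> = as q \<cdot> g q"
    using assms by (simp add: asc_step m_assoc)
  finally show ?case .
next
  case (step r)
  then have le: "r \<le> n" using assms by simp
  have "g (q + 1) \<cdot> as r = g r \<cdot> (g (q + 1) \<cdot> as (r + 1))"
    unfolding asc_step[OF le] by (rule g_commute_left[symmetric]) (use step assms in auto)
  also have "\<dots> = g r \<cdot> (as (r + 1) \<cdot> g q)" using step by simp
  also have "\<dots> = as r \<cdot> g q" using step assms by (simp add: asc_step m_assoc)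
  finally show ?case .
qed

text \<open>The ascending products represent the cosets of \<open>WA n (n - 1)\<close> in
  \<open>WA n n\<close>: a generator on the left either changes the representative or comes out on
  the right as a generator of the subgroup.\<close>

lemma g_asc:
  assumes "q \<in> {1..n}" "r \<in> {1..n + 1}"
  shows "(\<exists>r'\<in>{1..n + 1}. g q \<cdot> as r = as r') \<or> (\<exists>q'\<in>{1..n - 1}. g q \<cdot> as r = as r \<cdot> g q')"
proof -
  consider "q + 1 < r" | "r = q + 1" | "r = q" | "r < q" by linarith
  then show ?thesis
  proof cases
    case 1
    then show ?thesis using assms g_asc_below[of q r] by fastforce
  next
    case 2
    then show ?thesis using assms asc_step[of q n] by (intro disjI1 bexI[of _ q]) auto
  next
    case 3
    then show ?thesis using assms asc_step[of q n]
      by (intro disjI1 bexI[of _ "q + 1"]) (auto simp: g_square_left)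
  next
    case 4
    then show ?thesis using assms g_asc_above[of r "q - 1"]
      by (intro disjI2 bexI[of _ "q - 1"]) auto
  qed
qed

lemma R_gen_n: "R_gen n n = g n \<cdot> (g (n + 1) \<cdot> g n)"
  using n by (simp add: R_gen_def m_assoc)

text \<open>At the last factor, \<open>g (n + 1)\<close> is rewritten as its conjugate by
  \<open>g n\<close>; the earlier factors have indices between \<open>2\<close> and
  \<open>n - 1\<close> and commute with \<open>g (n + 1)\<close>.\<close>

lemma aff_asc:
  assumes "2 \<le> r" "r \<le> n"
  shows "g (n + 1) \<cdot> as r = as r \<cdot> R_gen n n"
  using assms(2,1)
proof (induction r rule: inc_induct)
  case base
  have "as n = g n" using asc_step[of n n] asc_top[of n] n by simp
  then show ?case using n by (simp add: R_gen_n g_square_left)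
next
  case (step r)
  then have le: "r \<le> n" by simp
  have b: "R_gen n n \<in> carrier (affA n)" using R_gen_carrier n by simp
  have "g (n + 1) \<cdot> as r = g r \<cdot> (g (n + 1) \<cdot> as (r + 1))"
    unfolding asc_step[OF le] by (rule g_commute_left[symmetric]) (use step in auto)
  also have "\<dots> = g r \<cdot> (as (r + 1) \<cdot> R_gen n n)" using step by simp
  also have "\<dots> = as r \<cdot> R_gen n n" using step b by (simp add: asc_step m_assoc)
  finally show ?case .
qed

text \<open>Acts on the class of \<open>n + 1\<close> as a shift by one period and normalizes the image of \<open>R\<close>.\<close>

definition translation :: "nat list set" where
  "translation = g (n + 1) \<cdot> as 1"

lemma translation_carrier [simp]: "translation \<in> carrier (affA n)"
  by (simp add: translation_def)

text \<open>Conjugation by \<open>translation\<close> rotates the cycle of generators of the image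
  of \<open>R\<close>: each \<open>g q\<close> goes to \<open>g (q + 1)\<close>,
  \<open>g (n - 1)\<close> goes to \<open>R_gen n n\<close>, and this goes to \<open>g 1\<close>.
  The three cases are proved here and in the next two lemmas.\<close>

lemma g_translation:
  assumes "1 \<le> q" "q < n - 1"
  shows "g (q + 1) \<cdot> translation = translation \<cdot> g q"
proof -
  have "g (q + 1) \<cdot> translation = g (n + 1) \<cdot> (g (q + 1) \<cdot> as 1)"
    unfolding translation_def using assms by (intro g_commute_left) auto
  also have "\<dots> = translation \<cdot> g q"
    using assms g_asc_above[of 1 q] by (simp add: translation_def m_assoc)
  finally show ?thesis .
qed

lemma g_1_translation: "g 1 \<cdot> translation = translation \<cdot> R_gen n n"
proof -
  have b: "R_gen n n \<in> carrier (affA n)" using R_gen_carrier n by simp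
  have as1: "as 1 = g 1 \<cdot> as 2" using asc_step[of 1 n] n by (simp add: numeral_2_eq_2)
  have "g 1 \<cdot> translation = g (n + 1) \<cdot> (g 1 \<cdot> (g (n + 1) \<cdot> as 2))"
    unfolding translation_def as1 by (rule g_braid_left) (use n in auto)
  also have "g (n + 1) \<cdot> as 2 = as 2 \<cdot> R_gen n n" using n by (intro aff_asc) auto
  finally show ?thesis using n b by (simp add: translation_def as1 m_assoc del: One_nat_def)
qed

lemma R_gen_n_translation: "R_gen n n \<cdot> translation = translation \<cdot> g (n - 1)"
proof -
  \<comment> \<open>The braid relation gives \<open>R_gen n n\<close> a second form that ends in
    \<open>g (n + 1)\<close>, which cancels the first factor of \<open>translation\<close>.\<close>
  have "g n \<cdot> (g (n + 1) \<cdot> (g n \<cdot> \<one>\<^bsub>affA n\<^esub>))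
      = g (n + 1) \<cdot> (g n \<cdot> (g (n + 1) \<cdot> \<one>\<^bsub>affA n\<^esub>))"
    by (rule g_braid_left) (use n in auto)
  then have "R_gen n n = g (n + 1) \<cdot> (g n \<cdot> g (n + 1))"
    using n by (simp add: R_gen_n)
  then have "R_gen n n \<cdot> translation = g (n + 1) \<cdot> (g n \<cdot> as 1)"
    using n by (simp add: translation_def m_assoc g_square_left)
  also have "g n \<cdot> as 1 = as 1 \<cdot> g (n - 1)" using n g_asc_above[of 1 "n - 1"] by simp
  finally show ?thesis using n by (simp add: translation_def m_assoc)
qed

lemma R_gen_translation: "q \<in> {1..n} \<Longrightarrow> \<exists>q'\<in>{1..n}. R_gen n q \<cdot> translation = translation \<cdot> R_gen n q'"
proof -
  assume q: "q \<in> {1..n}"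
  consider "q = 1" | "1 < q" "q < n" | "q = n" using q by force
  then show ?thesis
  proof cases
    case 1
    then show ?thesis using n g_1_translation by (intro bexI[of _ n]) (auto simp: R_gen_def)
  next
    case 2
    then show ?thesis using n g_translation[of "q - 1"] by (intro bexI[of _ "q - 1"]) (auto simp: R_gen_def)
  next
    case 3
    then show ?thesis using n R_gen_n_translation by (intro bexI[of _ "n - 1"]) (auto simp: R_gen_def)
  qed
qed

lemma translation_R_gen: "q \<in> {1..n} \<Longrightarrow> \<exists>q'\<in>{1..n}. translation \<cdot> R_gen n q = R_gen n q' \<cdot> translation"
proof -
  assume q: "q \<in> {1..n}"
  consider "q = n" | "q = n - 1" | "q < n - 1" using q by force
  then show ?thesis
  proof cases
    case 1
    then show ?thesis using n g_1_translation by (intro bexI[of _ 1]) (auto simp: R_gen_def)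
  next
    case 2
    then show ?thesis using n R_gen_n_translation by (intro bexI[of _ n]) (auto simp: R_gen_def)
  next
    case 3
    then show ?thesis using n q g_translation[of q] by (intro bexI[of _ "q + 1"]) (auto simp: R_gen_def)
  qed
qed

section \<open>The image of \<open>R\<close> and its cosets\<close>

definition R_image :: "nat list set set" where
  "R_image = R n ` carrier (affA (n - 1))"

abbreviation (input) "Rword u \<equiv> word_prod (affA n) (map (R_gen n) u)"

lemma Rword_carrier [simp]: "u \<in> lists {1..n} \<Longrightarrow> Rword u \<in> carrier (affA n)"
  using R_gen_carrier by (intro word_prod_closed) (auto simp: in_lists_conv_set)

lemma R_image_words: "R_image = Rword ` lists {1..n}"
proof -
  have eq: "affA (n - 1) = coxeter_group {1..n} (affA_matrix (n - 1))"
    using n by (simp add: affA_def)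
  have "carrier (affA (n - 1)) = word_class {1..n} (affA_matrix (n - 1)) ` lists {1..n}"
    unfolding eq by (blast intro: word_class_carrier elim: coxeter_group_carrierE)
  then show ?thesis using R_word_class[OF n] by (simp add: R_image_def image_image)
qed

lemma R_image_carrier: "h \<in> R_image \<Longrightarrow> h \<in> carrier (affA n)"
  unfolding R_image_words using Rword_carrier by blast

lemma R_image_one: "\<one>\<^bsub>affA n\<^esub> \<in> R_image"
  unfolding R_image_words by (rule image_eqI[of _ _ "[]"]) auto

lemma R_image_Cons:
  assumes "q \<in> {1..n}" "h \<in> R_image"
  shows "R_gen n q \<cdot> h \<in> R_image"
proof -
  obtain u where "u \<in> lists {1..n}" "h = Rword u" using assms(2) unfolding R_image_words by blast
  then show ?thesis unfolding R_image_words using assms(1) by (intro image_eqI[of _ _ "q # u"]) auto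
qed

lemma R_image_translation:
  assumes "h \<in> R_image"
  shows "\<exists>h'\<in>R_image. h \<cdot> translation = translation \<cdot> h'"
proof -
  have "\<exists>h'\<in>R_image. Rword u \<cdot> translation = translation \<cdot> h'" if "u \<in> lists {1..n}" for u
    using that
  proof (induction u)
    case Nil
    then show ?case by (intro bexI[OF _ R_image_one]) simp
  next
    case (Cons q u)
    then obtain h' where h': "h' \<in> R_image" "Rword u \<cdot> translation = translation \<cdot> h'" by auto
    obtain q' where q': "q' \<in> {1..n}" "R_gen n q \<cdot> translation = translation \<cdot> R_gen n q'"
      using R_gen_translation[of q] Cons by auto
    have "Rword (q # u) \<cdot> translation = R_gen n q \<cdot> translation \<cdot> h'"
      using Cons h' by (simp add: m_assoc R_gen_carrier R_image_carrier)
    also have "\<dots> = translation \<cdot> (R_gen n q' \<cdot> h')"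
      using h' q' by (simp add: m_assoc R_gen_carrier R_image_carrier)
    finally show ?case using R_image_Cons q' h' by blast
  qed
  then show ?thesis using assms unfolding R_image_words by blast
qed

lemma translation_R_image:
  assumes "h \<in> R_image"
  shows "\<exists>h'\<in>R_image. translation \<cdot> h = h' \<cdot> translation"
proof -
  have "\<exists>h'\<in>R_image. translation \<cdot> Rword u = h' \<cdot> translation" if "u \<in> lists {1..n}" for u
    using that
  proof (induction u)
    case Nil
    then show ?case by (intro bexI[OF _ R_image_one]) simp
  next
    case (Cons q u)
    then obtain h' where h': "h' \<in> R_image" "translation \<cdot> Rword u = h' \<cdot> translation" by auto
    obtain q' where q': "q' \<in> {1..n}" "translation \<cdot> R_gen n q = R_gen n q' \<cdot> translation"
      using translation_R_gen[of q] Cons by auto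
    have "translation \<cdot> Rword (q # u) = translation \<cdot> R_gen n q \<cdot> Rword u"
      using Cons by (simp add: m_assoc R_gen_carrier)
    also have "\<dots> = R_gen n q' \<cdot> (translation \<cdot> Rword u)"
      using Cons q' by (simp add: m_assoc R_gen_carrier)
    also have "\<dots> = (R_gen n q' \<cdot> h') \<cdot> translation"
      using h' q' by (simp add: m_assoc R_gen_carrier R_image_carrier)
    finally show ?case using R_image_Cons q' h' by blast
  qed
  then show ?thesis using assms unfolding R_image_words by blast
qed

text \<open>By induction on a word: a new generator on the left changes \<open>r\<close> or passes
  into \<open>h\<close>. The exponent changes only when \<open>g (n + 1)\<close> meets
  \<open>r = 1\<close> or \<open>r = n + 1\<close>.\<close>

lemma coset_decomposition:
  assumes "w \<in> carrier (affA n)"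
  shows "\<exists>r\<in>{1..n + 1}. \<exists>h\<in>R_image. \<exists>k::int. w = as r \<cdot> (h \<cdot> translation [^]\<^bsub>affA n\<^esub> k)"
proof -
  have "\<exists>r\<in>{1..n + 1}. \<exists>h\<in>R_image. \<exists>k::int. word_prod (affA n) (map g u) = as r \<cdot> (h \<cdot> translation [^]\<^bsub>affA n\<^esub> k)"
    if "u \<in> lists {1..n + 1}" for u
    using that
  proof (induction u)
    case Nil
    have "word_prod (affA n) (map g []) = as (n + 1) \<cdot> (\<one>\<^bsub>affA n\<^esub> \<cdot> translation [^]\<^bsub>affA n\<^esub> (0::int))"
      using asc_top[of n] by simp
    then show ?case using R_image_one by (metis atLeastAtMost_iff le_add2 order_refl)
  next
    case (Cons q u)
    then obtain r h k where rhk: "r \<in> {1..n + 1}" "h \<in> R_image"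
      "word_prod (affA n) (map g u) = as r \<cdot> (h \<cdot> translation [^]\<^bsub>affA n\<^esub> (k::int))" by auto
    have q: "q \<in> {1..n + 1}" using Cons by auto
    have hc: "h \<in> carrier (affA n)" using rhk R_image_carrier by blast
    have eq: "word_prod (affA n) (map g (q # u)) = (g q \<cdot> as r) \<cdot> (h \<cdot> translation [^]\<^bsub>affA n\<^esub> k)"
      using rhk q hc by (simp add: m_assoc)
    have stay: ?case if "q' \<in> {1..n}" "g q \<cdot> as r = as r \<cdot> R_gen n q'" for q'
    proof -
      have "word_prod (affA n) (map g (q # u)) = as r \<cdot> ((R_gen n q' \<cdot> h) \<cdot> translation [^]\<^bsub>affA n\<^esub> k)"
        unfolding eq using that rhk hc by (simp add: m_assoc R_gen_carrier)
      then show ?thesis using R_image_Cons[OF that(1) rhk(2)] rhk(1) by blast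
    qed
    consider "q \<le> n" | "q = n + 1" "r = 1" | "q = n + 1" "r = n + 1" | "q = n + 1" "2 \<le> r" "r \<le> n"
      using q rhk by force
    then show ?case
    proof cases
      case 1
      then consider r' where "r' \<in> {1..n + 1}" "g q \<cdot> as r = as r'"
        | q' where "q' \<in> {1..n - 1}" "g q \<cdot> as r = as r \<cdot> g q'"
        using g_asc[of q r] q rhk by auto
      then show ?thesis
      proof cases
        case 1
        then show ?thesis using eq rhk(2)
          by (intro bexI[of _ r'] bexI[of _ h] exI[of _ k]) simp_all
      next
        case 2
        then show ?thesis by (intro stay[of q']) (auto simp: R_gen_def)
      qed
    next
      case 2
      obtain h' where h': "h' \<in> R_image" "translation \<cdot> h = h' \<cdot> translation" using translation_R_image rhk by blast
      have hc': "h' \<in> carrier (affA n)" using h' R_image_carrier by blast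
      have "word_prod (affA n) (map g (q # u)) = (translation \<cdot> h) \<cdot> translation [^]\<^bsub>affA n\<^esub> k"
        unfolding eq using 2 hc by (simp add: translation_def m_assoc)
      also have "\<dots> = h' \<cdot> (translation \<cdot> translation [^]\<^bsub>affA n\<^esub> k)" using h' hc' by (simp add: m_assoc)
      also have "translation \<cdot> translation [^]\<^bsub>affA n\<^esub> k = translation [^]\<^bsub>affA n\<^esub> (1 + k)"
        using int_pow_mult[of translation 1 k] by simp
      finally have "word_prod (affA n) (map g (q # u)) = as (n + 1) \<cdot> (h' \<cdot> translation [^]\<^bsub>affA n\<^esub> (1 + k))"
        using hc' asc_top[of n] by simp
      then show ?thesis using h' by (metis atLeastAtMost_iff le_add2 order_refl)
    next
      case 3
      obtain h' where h': "h' \<in> R_image" "h \<cdot> translation = translation \<cdot> h'" using R_image_translation rhk by blast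
      have hc': "h' \<in> carrier (affA n)" using h' R_image_carrier by blast
      \<comment> \<open>Since \<open>g (n + 1)\<close> is an involution, \<open>as 1\<close> is
        \<open>g (n + 1)\<close> times \<open>translation\<close>; the extra translation is paid for
        by the exponent \<open>k - 1\<close>.\<close>
      have "as 1 \<cdot> (h' \<cdot> translation [^]\<^bsub>affA n\<^esub> (k - 1)) = g (n + 1) \<cdot> ((translation \<cdot> h') \<cdot> translation [^]\<^bsub>affA n\<^esub> (k - 1))"
        using hc' by (simp add: translation_def m_assoc g_square_left)
      also have "\<dots> = g (n + 1) \<cdot> (h \<cdot> (translation \<cdot> translation [^]\<^bsub>affA n\<^esub> (k - 1)))"
        using hc h'(2)[symmetric] by (simp add: m_assoc)
      also have "translation \<cdot> translation [^]\<^bsub>affA n\<^esub> (k - 1) = translation [^]\<^bsub>affA n\<^esub> k"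
        using int_pow_mult[of translation 1 "k - 1"] by simp
      finally have "word_prod (affA n) (map g (q # u)) = as 1 \<cdot> (h' \<cdot> translation [^]\<^bsub>affA n\<^esub> (k - 1))"
        unfolding eq using 3 asc_top[of n] hc by simp
      then show ?thesis using h' by (metis atLeastAtMost_iff le_add2 order_refl)
    next
      case 4
      then show ?thesis using n aff_asc[of r] by (intro stay[of n]) auto
    qed
  qed
  moreover obtain u where "u \<in> lists {1..n + 1}" "w = word_class {1..n + 1} (affA_matrix n) u"
    using assms by (rule affA_carrierE)
  ultimately show ?thesis using word_prod_gen[of u n] by metis
qed

section \<open>The stabilizer of \<open>n + 1\<close>\<close>

lemma act_translation: "act n translation (c, n + 1) = (c - 1, n + 1)"
  using n act_asc[of n 1 "n + 1" c] by (simp add: translation_def act_mult act_gen del: One_nat_def)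

lemma act_translation_pow: "act n (translation [^]\<^bsub>affA n\<^esub> (k::int)) (c, n + 1) = (c - k, n + 1)"
proof -
  have nat: "act n (translation [^]\<^bsub>affA n\<^esub> (m::nat)) (d, n + 1) = (d - int m, n + 1)" for m d
    using n by (induction m arbitrary: d) (simp_all add: act_one act_mult act_translation[simplified])
  show ?thesis
  proof (cases k rule: int_cases2)
    case (nonneg m)
    then show ?thesis using nat by (simp add: int_pow_int)
  next
    case (nonpos m)
    have "translation [^]\<^bsub>affA n\<^esub> k \<cdot> translation [^]\<^bsub>affA n\<^esub> int m = \<one>\<^bsub>affA n\<^esub>"
      using int_pow_mult[of translation k "int m"] nonpos by simp
    \<comment> \<open>The starting period \<open>c - k\<close> is chosen so that the positive power
      ends in period \<open>c\<close>.\<close>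
    then have "act n (translation [^]\<^bsub>affA n\<^esub> k) (act n (translation [^]\<^bsub>affA n\<^esub> int m) (c - k, n + 1)) = (c - k, n + 1)"
      using n act_mult[of n "translation [^]\<^bsub>affA n\<^esub> k" "translation [^]\<^bsub>affA n\<^esub> int m" "(c - k, n + 1)"]
      by (simp add: act_one)
    then show ?thesis using nat[of m "c - k"] nonpos by (simp add: int_pow_int)
  qed
qed

text \<open>Only \<open>R_gen n n\<close> touches \<open>n + 1\<close>: \<open>g n\<close> moves it
  to \<open>n\<close>, which \<open>g (n + 1)\<close> fixes, and the second \<open>g n\<close> moves
  it back.\<close>

lemma act_R_image:
  assumes "h \<in> R_image"
  shows "act n h (c, n + 1) = (c, n + 1)"
proof -
  have gen: "act n (R_gen n q) (c, n + 1) = (c, n + 1)" if "q \<in> {1..n}" for q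
    using that n by (auto simp: R_gen_def act_mult act_gen)
  have "act n (Rword u) (c, n + 1) = (c, n + 1)" if "u \<in> lists {1..n}" for u
    using that
  proof (induction u)
    case (Cons q u)
    then show ?case using n gen[of q] by (simp add: act_mult R_gen_carrier)
  qed (use n in \<open>simp add: act_one\<close>)
  then show ?thesis using assms unfolding R_image_words by auto
qed

text \<open>In the coset decomposition, \<open>w\<close> sends \<open>n + 1\<close> to
  \<open>(- k, r)\<close>; if this is \<open>(0, n + 1)\<close>, only the factor \<open>h\<close> is
  left.\<close>

lemma R_image_stabilizer:
  assumes "w \<in> carrier (affA n)"
  shows "w \<in> R_image \<longleftrightarrow> act n w (0, n + 1) = (0, n + 1)"
proof
  assume "w \<in> R_image"
  then show "act n w (0, n + 1) = (0, n + 1)" by (rule act_R_image)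
next
  assume fixed: "act n w (0, n + 1) = (0, n + 1)"
  obtain r h and k :: int where w: "r \<in> {1..n + 1}" "h \<in> R_image" "w = as r \<cdot> (h \<cdot> translation [^]\<^bsub>affA n\<^esub> k)"
    using coset_decomposition[OF assms] by blast
  have hc: "h \<in> carrier (affA n)" using w R_image_carrier by blast
  have "act n w (0, n + 1) = act n (as r) (act n h (act n (translation [^]\<^bsub>affA n\<^esub> k) (0, n + 1)))"
    using w n hc by (simp add: act_mult)
  also have "\<dots> = (- k, r)"
    using w n by (simp only: act_translation_pow act_R_image) (simp add: act_asc)
  finally have "k = 0" "r = n + 1" using fixed by auto
  then show "w \<in> R_image" using w asc_top[of n] hc by simp
qed

section \<open>Cosets of \<open>WA n (n - 1)\<close> in \<open>WA n n\<close>\<close>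

lemma WA_words:
  assumes "k \<le> n"
  shows "WA n k = (\<lambda>u. word_prod (affA n) (map g u)) ` lists {1..k}"
  unfolding WA_def
  by (rule involutions_generate[OF group_affA]) (use assms g_square in auto)

lemma WA_carrier:
  assumes "k \<le> n" "y \<in> WA n k"
  shows "y \<in> carrier (affA n)"
proof -
  obtain u where "u \<in> lists {1..k}" "y = word_prod (affA n) (map g u)"
    using assms WA_words by blast
  moreover from this have "set (map g u) \<subseteq> carrier (affA n)"
    using assms(1) by (fastforce simp: in_lists_conv_set)
  ultimately show ?thesis by simp
qed

lemma WA_Cons:
  assumes "k \<le> n" "q \<in> {1..k}" "y \<in> WA n k"
  shows "g q \<cdot> y \<in> WA n k"
  unfolding WA_def
  by (rule generate.eng[OF generate.incl]) (use assms in \<open>auto simp: WA_def\<close>)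

lemma WA_coset:
  assumes "x \<in> WA n n"
  shows "\<exists>r\<in>{1..n + 1}. \<exists>y\<in>WA n (n - 1). x = as r \<cdot> y"
proof -
  have "\<exists>r\<in>{1..n + 1}. \<exists>y\<in>WA n (n - 1). word_prod (affA n) (map g u) = as r \<cdot> y"
    if "u \<in> lists {1..n}" for u
    using that
  proof (induction u)
    case Nil
    have "\<one>\<^bsub>affA n\<^esub> \<in> WA n (n - 1)" unfolding WA_def by (rule generate.one)
    then show ?case using asc_top[of n] by (intro bexI[of _ "n + 1"] bexI[of _ "\<one>\<^bsub>affA n\<^esub>"]) auto
  next
    case (Cons q u)
    then obtain r y where ry: "r \<in> {1..n + 1}" "y \<in> WA n (n - 1)" "word_prod (affA n) (map g u) = as r \<cdot> y"
      by auto
    have q: "q \<in> {1..n}" using Cons by auto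
    have y: "y \<in> carrier (affA n)" using ry WA_carrier[of "n - 1"] by simp
    have eq: "word_prod (affA n) (map g (q # u)) = (g q \<cdot> as r) \<cdot> y"
      using ry q y by (simp add: m_assoc)
    from g_asc[OF q ry(1)] show ?case
    proof
      assume "\<exists>r'\<in>{1..n + 1}. g q \<cdot> as r = as r'"
      then show ?case using eq ry by metis
    next
      assume "\<exists>q'\<in>{1..n - 1}. g q \<cdot> as r = as r \<cdot> g q'"
      then obtain q' where q': "q' \<in> {1..n - 1}" "g q \<cdot> as r = as r \<cdot> g q'" by blast
      then have "g q' \<in> carrier (affA n)" by auto
      with q' have "word_prod (affA n) (map g (q # u)) = as r \<cdot> (g q' \<cdot> y)"
        unfolding eq using ry y by (simp add: m_assoc)
      then show ?case using WA_Cons[of "n - 1" q' y] q' ry by auto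
    qed
  qed
  then show ?thesis using assms WA_words[of n] by auto
qed

lemma act_WA:
  assumes "y \<in> WA n (n - 1)"
  shows "act n y (c, n + 1) = (c, n + 1)"
proof -
  have "act n (word_prod (affA n) (map g u)) (c, n + 1) = (c, n + 1)" if "u \<in> lists {1..n - 1}" for u
  proof -
    have u: "s \<in> {1..n - 1}" if "s \<in> set u" for s
      using that \<open>u \<in> lists {1..n - 1}\<close> by (auto simp: in_lists_conv_set)
    then have "set (map g u) \<subseteq> carrier (affA n)" by fastforce
    moreover have "foldr (\<lambda>s. act n (g s)) u (c, n + 1) = (c, n + 1)"
      using u n
    proof (induction u)
      case (Cons s u)
      have "s \<in> {1..n - 1}" by (rule Cons.prems(1)) simp
      then have "act n (g s) (c, n + 1) = (c, n + 1)" using n by (subst act_gen) auto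
      with Cons show ?case by simp
    qed simp
    ultimately show ?thesis using n act_word_prod[of n u g "(c, n + 1)"] by auto
  qed
  then show ?thesis using assms WA_words[of "n - 1"] by auto
qed

lemma act_WA_coset:
  assumes "r \<in> {1..n + 1}" "y \<in> WA n (n - 1)"
  shows "act n (as r \<cdot> y) (c, n + 1) = (c, r)"
  using assms n WA_carrier[of "n - 1" y] act_WA[OF assms(2), of c] act_asc[of n r "n + 1" c]
  by (simp add: act_mult)

text \<open>Different ascending products send \<open>n + 1\<close> to different points, so its image
  determines the coset. This turns the condition on \<open>x\<close> into one on the start of the
  trajectory.\<close>

lemma WA_coset_iff:
  assumes "x \<in> WA n n" "r \<in> {1..n + 1}"
  shows "(\<exists>y\<in>WA n (n - 1). x = as r \<cdot> y) \<longleftrightarrow> act n x (0, n + 1) = (0, r)"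
  using WA_coset[OF assms(1)] act_WA_coset assms(2) by fastforce

end

section \<open>The trajectory of a point along a canonical form\<close>

lemma factor_step_range:
  assumes "1 \<le> snd p" "snd p \<le> n + 1" "1 \<le> j" "j \<le> n + 1" "i + 1 \<le> n"
  shows "1 \<le> snd (factor_step n j i p) \<and> snd (factor_step n j i p) \<le> n + 1"
  using assms by (cases p) auto

text \<open>The factor of \<open>j'\<close> and \<open>i'\<close> follows the one of
  \<open>i\<close>. To lie in a lower period, \<open>p'\<close> would have to be at
  \<open>n + 1\<close>; then \<open>p\<close> would be at \<open>i' + 2\<close>, or at
  \<open>i' + 1\<close> with \<open>i < i'\<close>, in both cases beyond
  \<open>i + 1\<close>.\<close>

lemma factor_step_positive:
  assumes "factor_step n j' i' p' = p" "1 \<le> snd p'" "snd p' \<le> n + 1" "i' + 1 \<le> n"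
    and "i \<le> i'" "i' + 1 < j' \<Longrightarrow> i < i'"
    and "fst p \<ge> 1" "snd p \<le> i + 1"
  shows "fst p' \<ge> 1 \<and> snd p' \<le> i' + 1"
  using assms by (cases p') (auto split: if_splits)

text \<open>The mirror image: to lie in a higher period, \<open>p'\<close> would have to be at
  \<open>1\<close>, and \<open>p\<close> at \<open>j'\<close>, which the inequalities place outside
  the region. The second alternative closes the region under preimages, as a point at
  \<open>j' > i' + 1\<close> is moved up to \<open>j' + 1\<close>.\<close>

lemma factor_step_negative:
  assumes "factor_step n j' i' p' = p" "1 \<le> snd p'" "snd p' \<le> n + 1" "j' \<le> n"
    and "j' \<le> j" "i + 1 < j \<Longrightarrow> j' < j"
    and "fst p \<le> -1" "j < snd p \<or> snd p = j \<and> i + 1 < j"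
  shows "fst p' \<le> -1 \<and> (j' < snd p' \<or> snd p' = j' \<and> i' + 1 < j')"
  using assms by (cases p') (auto split: if_splits)

text \<open>The point \<open>n + 1 - k\<close> lies above \<open>i + 1\<close> and not below
  \<open>j\<close>, so it is raised by one. Points that cross a period boundary land at
  \<open>j\<close>, \<open>i + 1\<close> or \<open>i + 2\<close>, all below
  \<open>n + 2 - k\<close>.\<close>

lemma factor_step_descend:
  assumes "1 \<le> q" "q \<le> n + 1" "1 \<le> k" "i + k < n" "j + k \<le> n + 1"
  shows "factor_step n j i (c, q) = (0, n + 2 - k) \<longleftrightarrow> c = 0 \<and> q = n + 1 - k"
  using assms by auto

text \<open>The descending product lowers the point by one and the ascending product raises it
  again.\<close>

lemma factor_step_stay:
  assumes "1 \<le> q" "q \<le> n + 1" "s < n" "1 \<le> s" "n \<le> i + s" "j + s \<le> n"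
  shows "factor_step n j i (c, q) = (0, n + 1 - s) \<longleftrightarrow> c = 0 \<and> q = n + 1 - s"
  using assms by auto

text \<open>In this borderline case the target is \<open>i + 2\<close>, exactly where
  \<open>n + 1\<close> lands when it comes from the preceding period.\<close>

lemma factor_step_fall:
  assumes "1 \<le> q" "q \<le> n + 1" "i + s + 1 = n" "j + s \<le> n"
    and "factor_step n j i (c, q) = (0, n + 1 - s)"
  shows "c = -1 \<and> q = n + 1"
  using assms by (auto split: if_splits)

text \<open>For \<open>j = n + 1\<close> the ascending product is empty, and \<open>n + 1\<close> is
  reached only from \<open>1\<close> in the next period.\<close>

lemma factor_step_rise:
  assumes "1 \<le> q" "q \<le> n + 1" "i + 1 \<le> n" "j = n + 1"
    and "factor_step n j i (c, q) = (0, n + 1)"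
  shows "c = 1 \<and> q = 1"
  using assms by (auto split: if_splits)

section \<open>The path of \<open>n + 1\<close> under the pairwise inequalities\<close>

locale trajectory =
  fixes n m r :: nat and j i :: "nat \<Rightarrow> nat"
  assumes n: "n \<ge> 3" and m: "m \<ge> 1"
    and ineq: "pairwise_inequalities n m j i"
    and r: "1 \<le> r" "r \<le> n + 1"
begin

text \<open>
  \<open>P k\<close> is the position of \<open>n + 1\<close> after the factors \<open>k + 1, \<dots>, m\<close> have been applied to its image \<open>r\<close>
  under \<open>x\<close>.
\<close>

definition P :: "nat \<Rightarrow> int \<times> nat" where
  "P k = foldr (\<lambda>s. factor_step n (j s) (i s)) [Suc k..<Suc m] (0, r)"

lemma P_last: "P m = (0, r)"
  by (simp add: P_def)

lemma P_step:
  assumes "k < m"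
  shows "P k = factor_step n (j (Suc k)) (i (Suc k)) (P (Suc k))"
  using assms upt_conv_Cons[of "Suc k" "Suc m"] by (simp add: P_def del: upt_Suc)

lemma bounds:
  assumes "1 \<le> k" "k \<le> m"
  shows "1 \<le> j k" "j k \<le> n + 1" "i k + 1 \<le> n"
proof -
  have "k = 1 \<or> k \<in> {2..m}" using assms by auto
  then show "1 \<le> j k" "j k \<le> n + 1" "i k + 1 \<le> n"
    using ineq n unfolding pairwise_inequalities_def by fastforce+
qed

lemma next_ineq:
  assumes "1 \<le> k" "k < m"
  shows "j (Suc k) \<le> n" "j (Suc k) \<le> j k" "i k \<le> i (Suc k)"
    "i k + 1 < j k \<Longrightarrow> j (Suc k) < j k"
    "i (Suc k) + 1 < j (Suc k) \<Longrightarrow> i k < i (Suc k)"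
proof -
  have k: "Suc k \<in> {2..m}" using assms by auto
  show "j (Suc k) \<le> n" "j (Suc k) \<le> j k" "i k \<le> i (Suc k)"
    "i k + 1 < j k \<Longrightarrow> j (Suc k) < j k"
    "i (Suc k) + 1 < j (Suc k) \<Longrightarrow> i k < i (Suc k)"
    using ineq[unfolded pairwise_inequalities_def] k n by fastforce+
qed

lemma i_mono:
  assumes "1 \<le> k" "k \<le> l" "l \<le> m"
  shows "i k \<le> i l"
  using assms(2,3)
proof (induction l rule: dec_induct)
  case (step l)
  then show ?case using next_ineq(3)[of l] assms(1) by simp
qed simp

lemma P_range:
  assumes "k \<le> m"
  shows "1 \<le> snd (P k) \<and> snd (P k) \<le> n + 1"
  using assms
proof (induction k rule: inc_induct)
  case base
  then show ?case using r by (simp add: P_last)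
next
  case (step k)
  then show ?case
    using factor_step_range[of "P (Suc k)" n "j (Suc k)" "i (Suc k)"] bounds[of "Suc k"] P_step[of k]
    by simp
qed

text \<open>The region propagates to every later index, but \<open>P m\<close> lies in period
  \<open>0\<close>. The negative case below is analogous.\<close>

lemma no_return_positive:
  assumes "1 \<le> k" "k \<le> m" "fst (P k) \<ge> 1" "snd (P k) \<le> i k + 1"
  shows False
proof -
  have "fst (P l) \<ge> 1 \<and> snd (P l) \<le> i l + 1" if "k \<le> l" "l \<le> m" for l
    using that
  proof (induction l rule: dec_induct)
    case base
    then show ?case using assms by simp
  next
    case (step l)
    show ?case
      by (rule factor_step_positive[OF P_step[of l, symmetric], where i = "i l"])
        (use step assms(1) P_range[of "Suc l"] bounds[of "Suc l"] next_ineq[of l] in auto)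
  qed
  from this[of m] show False using assms P_last by simp
qed

lemma no_return_negative:
  assumes "1 \<le> k" "k \<le> m" "fst (P k) \<le> -1" "j k < snd (P k)"
  shows False
proof -
  have "fst (P l) \<le> -1 \<and> (j l < snd (P l) \<or> snd (P l) = j l \<and> i l + 1 < j l)"
    if "k \<le> l" "l \<le> m" for l
    using that
  proof (induction l rule: dec_induct)
    case base
    then show ?case using assms by simp
  next
    case (step l)
    show ?case
      by (rule factor_step_negative[OF P_step[of l, symmetric], where j = "j l" and i = "i l"])
        (use step assms(1) P_range[of "Suc l"] next_ineq[of l] in auto)
  qed
  from this[of m] show False using assms P_last by simp
qed

lemma j_1_le:
  assumes "P 0 = (0, n + 1)"
  shows "j 1 \<le> n"
proof (rule ccontr)
  assume "\<not> j 1 \<le> n"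
  then have j: "j 1 = n + 1" using bounds[of 1] m by simp
  obtain c q where p: "P 1 = (c, q)" by force
  have "c = 1 \<and> q = 1"
    by (rule factor_step_rise[of q n "i 1" "j 1" c])
      (use P_range[of 1] P_step[of 0] m p assms bounds[of 1] j in auto)
  then show False using no_return_positive[of 1] m p by simp
qed

section \<open>The path before and after the critical index\<close>

context
  fixes s :: nat
  assumes s: "s \<le> m" and before: "\<And>k. 1 \<le> k \<Longrightarrow> k \<le> s \<Longrightarrow> i k + k < n"
    and after: "s < m \<Longrightarrow> n \<le> i (s + 1) + (s + 1)"
    and j_1: "j 1 \<le> n"
begin

text \<open>If the bound is attained at an index up to \<open>s\<close>, then \<open>before\<close>
  gives \<open>i k + 1 < j k\<close> there and forces a strict drop of \<open>j\<close>; otherwise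
  there is room for \<open>j\<close> to stay constant.\<close>

lemma j_bound:
  assumes "k \<le> s" "k < m"
  shows "j (Suc k) + Suc k \<le> n + 1"
  using assms
proof (induction k)
  case 0
  then show ?case using j_1 by simp
next
  case (Suc k)
  then show ?case using next_ineq(2,4)[of "Suc k"] before[of "Suc k"] by fastforce
qed

lemma P_before:
  assumes "P 0 = (0, n + 1)" "k \<le> s"
  shows "P k = (0, n + 1 - k)"
  using assms(2)
proof (induction k)
  case 0
  then show ?case using assms by simp
next
  case (Suc k)
  obtain c q where p: "P (Suc k) = (c, q)" by force
  have "factor_step n (j (Suc k)) (i (Suc k)) (c, q) = (0, n + 2 - Suc k)"
    using Suc P_step[of k] s p by simp
  then have "c = 0 \<and> q = n + 1 - Suc k"
    by (subst (asm) factor_step_descend)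
      (use Suc P_range[of "Suc k"] s p before[of "Suc k"] j_bound[of k] in auto)
  then show ?case using p by simp
qed

text \<open>After \<open>s\<close>, \<open>i\<close> never decreases and \<open>j\<close> never
  increases, so what \<open>factor_step_stay\<close> requires holds for all remaining factors once
  it holds at \<open>s + 1\<close>.\<close>

lemma stays:
  assumes "n < i (s + 1) + (s + 1)" "1 \<le> s" "s \<le> k" "k < m"
  shows "P k = (0, n + 1 - s) \<longleftrightarrow> P (Suc k) = (0, n + 1 - s)"
proof -
  obtain c q where p: "P (Suc k) = (c, q)" by force
  have "j l \<le> j (Suc s)" if "Suc s \<le> l" "l \<le> m" for l
    using that
  proof (induction l rule: dec_induct)
    case (step l)
    then show ?case using next_ineq(2)[of l] by simp
  qed simp
  then have "j (Suc k) + s \<le> n" using assms j_bound[of s] by fastforce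
  moreover have "n \<le> i (Suc k) + s" using i_mono[of "Suc s" "Suc k"] assms by simp
  moreover have "s < n" using before[of s] assms by simp
  ultimately have "factor_step n (j (Suc k)) (i (Suc k)) (c, q) = (0, n + 1 - s)
      \<longleftrightarrow> c = 0 \<and> q = n + 1 - s"
    using factor_step_stay P_range[of "Suc k"] p assms by fastforce
  then show ?thesis using P_step[of k] p assms by simp
qed

text \<open>Only equality has to be excluded. It would put \<open>P (s + 1)\<close> at
  \<open>n + 1\<close> in period \<open>-1\<close>, above \<open>j (s + 1)\<close>, from where no
  path leads to period \<open>0\<close>.\<close>

lemma after_strict:
  assumes "P 0 = (0, n + 1)" "s < m"
  shows "n < i (s + 1) + (s + 1)"
proof (rule ccontr)
  assume "\<not> ?thesis"
  then have eq: "i (Suc s) + s + 1 = n" using after assms(2) by simp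
  obtain c q where p: "P (Suc s) = (c, q)" by force
  have "c = -1 \<and> q = n + 1"
    by (rule factor_step_fall[of q n "i (Suc s)" s "j (Suc s)" c])
      (use P_range[of "Suc s"] P_step[of s] P_before[OF assms(1), of s] p assms eq j_bound[of s] in auto)
  then show False using no_return_negative[of "Suc s"] p assms j_bound[of s] by simp
qed

lemma P_0_iff:
  "P 0 = (0, n + 1) \<longleftrightarrow> 1 \<le> s \<and> (s < m \<longrightarrow> n < i (s + 1) + (s + 1)) \<and> r = n + 1 - s"
proof
  assume P0: "P 0 = (0, n + 1)"
  have s1: "1 \<le> s"
  proof (rule ccontr)
    assume "\<not> 1 \<le> s"
    then have "s = 0" by simp
    then have "n < i 1 + 1" using after_strict[OF P0] m by simp
    then show False using bounds[of 1] m by simp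
  qed
  have "P k = (0, n + 1 - s)" if "s \<le> k" "k \<le> m" for k
    using that
  proof (induction k rule: dec_induct)
    case base
    then show ?case using P_before[OF P0, of s] by simp
  next
    case (step k)
    then show ?case using stays[of k] after_strict[OF P0] s1 by simp
  qed
  from this[of m] have "r = n + 1 - s" using s P_last by simp
  then show "1 \<le> s \<and> (s < m \<longrightarrow> n < i (s + 1) + (s + 1)) \<and> r = n + 1 - s"
    using s1 after_strict[OF P0] by simp
next
  assume *: "1 \<le> s \<and> (s < m \<longrightarrow> n < i (s + 1) + (s + 1)) \<and> r = n + 1 - s"
  have "P k = (0, n + 1 - s)" if "s \<le> k" "k \<le> m" for k
    using that(2,1)
  proof (induction k rule: inc_induct)
    case base
    then show ?case using * P_last by simp
  next
    case (step k)
    then show ?case using stays[of k] * by simp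
  qed
  from this[of s] have P_s: "P s = (0, n + 1 - s)" using s by simp
  \<comment> \<open>Induction on the distance from \<open>s\<close>, since the path is now followed
    back to \<open>P 0\<close>.\<close>
  have "P (s - l) = (0, n + 1 - (s - l))" if "l \<le> s" for l
    using that
  proof (induction l)
    case 0
    then show ?case using P_s by simp
  next
    case (Suc l)
    define k where "k = s - Suc l"
    have k: "s - l = Suc k" "k < s" using Suc by (auto simp: k_def)
    have "P k = factor_step n (j (Suc k)) (i (Suc k)) (0, n + 1 - Suc k)"
      using P_step[of k] k s Suc by simp
    also have "\<dots> = (0, n + 2 - Suc k)"
      by (subst factor_step_descend) (use k s before[of "Suc k"] j_bound[of k] in auto)
    finally show ?case by (simp add: k_def)
  qed
  from this[of s] show "P 0 = (0, n + 1)" by simp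
qed

end

lemma P_0_fixed_iff:
  "P 0 = (0, n + 1) \<longleftrightarrow>
    (j 1 \<le> n \<and> i 1 < n - 1) \<and>
    (let s = Max {k. 1 \<le> k \<and> k \<le> m \<and> int (i k) < int n - int k} in
      (s < m \<longrightarrow> int (i (s + 1)) > int n - int (s + 1)) \<and> r = n - s + 1)"
proof (cases "j 1 \<le> n")
  case False
  then show ?thesis using j_1_le by blast
next
  case True
  define S where "S = {k. 1 \<le> k \<and> k \<le> m \<and> int (i k) < int n - int k}"
  have S: "k \<in> S \<longleftrightarrow> 1 \<le> k \<and> k \<le> m \<and> i k + k < n" for k by (auto simp: S_def)
  have fin: "finite S" by (rule finite_subset[of _ "{..m}"]) (auto simp: S_def)
  show ?thesis
  proof (cases "1 \<in> S")
    case i1: True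
    define s where "s = Max S"
    have "s \<in> S" unfolding s_def by (rule Max_in) (use fin i1 in auto)
    then have s: "1 \<le> s" "s \<le> m" "i s + s < n" by (auto simp: S)
    \<comment> \<open>As \<open>i\<close> is nondecreasing, \<open>S\<close> is an initial segment,
      so its maximum is the last index before the first failure.\<close>
    have before: "i k + k < n" if "1 \<le> k" "k \<le> s" for k
      using i_mono[of k s] s that by simp
    have after: "n \<le> i (s + 1) + (s + 1)" if "s < m"
    proof (rule ccontr)
      assume "\<not> ?thesis"
      then have "s + 1 \<in> S" using that by (simp add: S)
      then show False using Max_ge[OF fin, of "s + 1"] by (simp add: s_def)
    qed
    have "i 1 < n - 1" using i1 by (auto simp: S)
    moreover have "int (i (s + 1)) > int n - int (s + 1) \<longleftrightarrow> n < i (s + 1) + (s + 1)" by linarith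
    moreover have "n + 1 - s = n - s + 1" using s by simp
    ultimately show ?thesis
      using P_0_iff[OF s(2) before after True] True s(1)
      unfolding S_def[symmetric] s_def[symmetric] Let_def by simp
  next
    case False
    \<comment> \<open>The right side is false whatever the value of \<open>Max\<close>; the left
      side is refuted by \<open>P_0_iff\<close> with \<open>s = 0\<close>.\<close>
    then have "\<not> i 1 < n - 1" using m by (auto simp: S)
    moreover have "\<not> P 0 = (0, n + 1)"
      using P_0_iff[of 0] False m True by (auto simp: S)
    ultimately show ?thesis by simp
  qed
qed

end

section \<open>From the group element to its trajectory\<close>

lemma act_factors:
  assumes "n \<ge> 2" "1 \<le> snd p" "snd p \<le> n + 1"
    and "\<And>s. s \<in> set xs \<Longrightarrow> 1 \<le> j s \<and> j s \<le> n + 1 \<and> i s + 1 \<le> n"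
  shows "foldr (\<lambda>s. act n (hh n (j s) (i s) \<otimes>\<^bsub>affA n\<^esub> aff n)) xs p
      = foldr (\<lambda>s. factor_step n (j s) (i s)) xs p \<and>
    1 \<le> snd (foldr (\<lambda>s. factor_step n (j s) (i s)) xs p) \<and>
    snd (foldr (\<lambda>s. factor_step n (j s) (i s)) xs p) \<le> n + 1"
  using assms(4)
proof (induction xs)
  case Nil
  then show ?case using assms by simp
next
  case (Cons s xs)
  obtain c q where p: "foldr (\<lambda>s. factor_step n (j s) (i s)) xs p = (c, q)" by force
  have s: "1 \<le> j s" "j s \<le> n + 1" "i s + 1 \<le> n" using Cons.prems[of s] by auto
  note IH = Cons.IH[OF Cons.prems[OF list.set_intros(2)]]
  have q: "1 \<le> q" "q \<le> n + 1" using IH unfolding p by simp_all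
  have "foldr (\<lambda>s. act n (hh n (j s) (i s) \<otimes>\<^bsub>affA n\<^esub> aff n)) xs p = (c, q)"
    using IH unfolding p by simp
  moreover have "act n (hh n (j s) (i s) \<otimes>\<^bsub>affA n\<^esub> aff n) (c, q) = factor_step n (j s) (i s) (c, q)"
    by (rule act_factor) (use assms(1) s q in auto)
  moreover have "1 \<le> snd (factor_step n (j s) (i s) (c, q)) \<and> snd (factor_step n (j s) (i s) (c, q)) \<le> n + 1"
    by (rule factor_step_range) (use s q in auto)
  ultimately show ?case by (simp only: foldr_Cons o_def p)
qed

theorem corollary5p6:
  fixes n m :: nat and j i :: "nat \<Rightarrow> nat" and w x :: "nat list set"
  assumes "n \<ge> 3" and "m \<ge> 1"
    and "w \<in> carrier (affA n)"
    and "affine_length n w = m"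
    and "canonical_form n m j i x w"
  shows "w \<in> R n ` carrier (affA (n - 1)) \<longleftrightarrow>
    (j 1 \<le> n \<and> i 1 < n - 1) \<and>
    (let s = Max {k. 1 \<le> k \<and> k \<le> m \<and> int (i k) < int n - int k} in
      (s < m \<longrightarrow> int (i (s + 1)) > int n - int (s + 1)) \<and>
      (\<exists>y \<in> WA n (n - 1). x = asc n (n - s + 1) n \<otimes>\<^bsub>affA n\<^esub> y))"
proof -
  interpret group "affA n" by (rule group_affA)
  define F where "F = (\<lambda>s. hh n (j s) (i s) \<otimes>\<^bsub>affA n\<^esub> aff n)"
  have ineq: "pairwise_inequalities n m j i" and x: "x \<in> WA n n"
    and w: "w = word_prod (affA n) (map F [1..<m + 1]) \<otimes>\<^bsub>affA n\<^esub> x"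
    using assms(5) by (auto simp: canonical_form_def F_def)
  \<comment> \<open>The representative of the coset of \<open>x\<close> gives the point
    \<open>r\<close> from which the trajectory starts.\<close>
  obtain r y where "r \<in> {1..n + 1}" "y \<in> WA n (n - 1)" "x = asc n r n \<otimes>\<^bsub>affA n\<^esub> y"
    using WA_coset[OF assms(1) x] by blast
  then have r: "r \<in> {1..n + 1}" and act_x: "act n x (0, n + 1) = (0, r)"
    using act_WA_coset[OF assms(1)] by auto
  interpret trajectory n m r j i
    by unfold_locales (use assms ineq r in auto)
  have valid: "1 \<le> j s \<and> j s \<le> n + 1 \<and> i s + 1 \<le> n" if "s \<in> set [1..<m + 1]" for s
    using that bounds[of s] by auto
  have F: "F s \<in> carrier (affA n)" if "s \<in> set [1..<m + 1]" for s
    using valid[OF that] hh_carrier[of "j s" "i s" n] gen_carrier[of "n + 1" n] by (simp add: F_def)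
  then have "set (map F [1..<m + 1]) \<subseteq> carrier (affA n)" by auto
  then have "act n w (0, n + 1) = act n (word_prod (affA n) (map F [1..<m + 1])) (0, r)"
    using w act_x act_mult[of n _ x] WA_carrier[OF assms(1) _ x] assms(1) by simp
  also have "\<dots> = foldr (\<lambda>s. act n (F s)) [1..<m + 1] (0, r)"
    by (rule act_word_prod) (use F assms(1) in auto)
  also have "\<dots> = P 0"
    using act_factors[of n "(0, r)" "[1..<m + 1]" j i] valid assms(1) r
    by (simp add: F_def P_def)
  finally have "act n w (0, n + 1) = P 0" .
  then have "w \<in> R n ` carrier (affA (n - 1)) \<longleftrightarrow> P 0 = (0, n + 1)"
    using R_image_stabilizer[OF assms(1,3)] R_image_def[OF assms(1)] by simp
  \<comment> \<open>Natural subtraction keeps \<open>n - s + 1\<close> between \<open>1\<close> and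
    \<open>n + 1\<close> for every \<open>s\<close>, so \<open>WA_coset_iff\<close> applies without
    knowing the maximum.\<close>
  moreover have "r = n - s + 1 \<longleftrightarrow> (\<exists>y\<in>WA n (n - 1). x = asc n (n - s + 1) n \<otimes>\<^bsub>affA n\<^esub> y)" for s
    using WA_coset_iff[OF assms(1) x, of "n - s + 1"] act_x by auto
  ultimately show ?thesis using P_0_fixed_iff by simp
qed


end
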